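(* Let $K\subset\mathbb{R}$ be a field, let $\mathbf{g}=\{g_1,\dots,g_r\}$ and $\mathbf{h}=\{h_1,\dots,h_s\}$ be finite sets of polynomials in $K[\mathbf{x}]=K[x_1,\dots,x_n]$ such that the ideal $I=(\mathbf{h})\subset K[\mathbf{x}]$ is zero-dimensional and radical, let $B$ be a monomial basis of $K[\mathbf{x}]/I$ with $|B|=D$, and let $$S=\{\xi\in\mathbb{R}^n : g_i(\xi)\ge 0 \text{ for } 1\le i\le r \text{ and } h_j(\xi)=0 \text{ for } 1\le j\le s\}.$$ Then for $f\in K[\mathbf{x}]$, one has $f\ge0$ on $S$ if and only if there exist $\omega_{i,k}\in K_{\ge0}$ and $q_{i,k}\in\langle B\rangle_K$ ($0\le i\le r$, $1\le k\le D$) and $p_j\in K[\mathbf{x}]$ ($1\le j\le s$) such that $$f=\sum_{k=1}^D\omega_{0,k}\,q_{0,k}^2+\sum_{i=1}^r\Big(\sum_{k=1}^D\omega_{i,k}\,q_{i,k}^2\Big)g_i+\sum_{j=1}^s p_jh_j .$$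
   Context: An ideal $I\subset K[\mathbf{x}]$ is zero-dimensional if its set of common zeros in $\mathbb{C}^n$ is finite, equivalently if $K[\mathbf{x}]/I$ is a finite-dimensional $K$-vector space. A monomial basis $B$ of $K[\mathbf{x}]/I$ is a set of monomials whose classes form a $K$-basis of $K[\mathbf{x}]/I$; $\langle B\rangle_K\subset K[\mathbf{x}]$ is the $K$-vector space spanned by $B$. $K_{\ge0}=\{\omega\in K:\omega\ge0\}$. *)

theory Defs
  imports "HOL-Analysis.Analysis" "HOL-Library.Poly_Mapping"
begin

text \<open>
  Polynomials in the variables indexed by the finite type 'n, with real coefficients, are finitely
  supported maps from exponent vectors to coefficients. A field K of real numbers is a set of reals,
  and K[x] is the subring of the polynomials all of whose coefficients lie in K.
\<close>

type_synonym 'n mpoly = "('n \<Rightarrow>\<^sub>0 nat) \<Rightarrow>\<^sub>0 real"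

definition real_subfield :: "real set \<Rightarrow> bool" where
  "real_subfield K \<longleftrightarrow>
     0 \<in> K \<and> 1 \<in> K \<and>
     (\<forall>a\<in>K. \<forall>b\<in>K. a + b \<in> K \<and> a * b \<in> K) \<and>
     (\<forall>a\<in>K. - a \<in> K \<and> inverse a \<in> K)"

definition poly_ring :: "real set \<Rightarrow> 'n mpoly set" where
  "poly_ring K = {p. \<forall>m. Poly_Mapping.lookup p m \<in> K}"

definition Const :: "real \<Rightarrow> 'n mpoly" where
  "Const c = Poly_Mapping.single 0 c"

definition monomials :: "'n mpoly set" where
  "monomials = range (\<lambda>m. Poly_Mapping.single m 1)"

text \<open>Used with points of both \<open>real ^ 'n\<close> and \<open>complex ^ 'n\<close>.\<close>

definition poly_eval :: "'n::finite mpoly \<Rightarrow> 'a::{real_algebra_1,comm_ring_1} ^ 'n \<Rightarrow> 'a" where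
  "poly_eval p x =
     (\<Sum>m\<in>Poly_Mapping.keys p.
        of_real (Poly_Mapping.lookup p m) * (\<Prod>i\<in>UNIV. (x $ i) ^ Poly_Mapping.lookup m i))"

text \<open>
  All finite linear combinations of elements of X with coefficients in the subring R. With
  \<open>R = poly_ring K\<close> this is the ideal of K[x] generated by X; with \<open>R = Const ` K\<close>
  it is the K-vector space spanned by X.
\<close>

definition lin_combs :: "'n mpoly set \<Rightarrow> 'n mpoly set \<Rightarrow> 'n mpoly set" where
  "lin_combs R X = {\<Sum>x\<in>F. c x * x | F c. finite F \<and> F \<subseteq> X \<and> (\<forall>x\<in>F. c x \<in> R)}"

definition gen_ideal :: "real set \<Rightarrow> 'n mpoly set \<Rightarrow> 'n mpoly set" where
  "gen_ideal K X = lin_combs (poly_ring K) X"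

definition K_span :: "real set \<Rightarrow> 'n mpoly set \<Rightarrow> 'n mpoly set" where
  "K_span K X = lin_combs (Const ` K) X"

definition zero_dimensional :: "'n::finite mpoly set \<Rightarrow> bool" where
  "zero_dimensional I \<longleftrightarrow> finite {z :: complex ^ 'n. \<forall>p\<in>I. poly_eval p z = 0}"

definition radical_ideal :: "real set \<Rightarrow> 'n mpoly set \<Rightarrow> bool" where
  "radical_ideal K I \<longleftrightarrow> {p \<in> poly_ring K. \<exists>m\<ge>1. p ^ m \<in> I} = I"

definition residue_class :: "'n mpoly set \<Rightarrow> 'n mpoly \<Rightarrow> 'n mpoly set" where
  "residue_class I p = {p + a | a. a \<in> I}"

text \<open>
  The residue classes of the elements of B, taken as a family indexed by B, form a K-basis of
  K[x]/I. In particular distinct elements of B have distinct classes. Linear combinations in the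
  quotient are the classes of the corresponding linear combinations of representatives.
\<close>

definition monomial_basis :: "real set \<Rightarrow> 'n mpoly set \<Rightarrow> 'n mpoly set \<Rightarrow> bool" where
  "monomial_basis K I B \<longleftrightarrow>
     B \<subseteq> monomials \<and>
     (\<forall>F c. finite F \<and> F \<subseteq> B \<and> (\<forall>b\<in>F. c b \<in> K) \<and>
        residue_class I (\<Sum>b\<in>F. Const (c b) * b) = residue_class I 0 \<longrightarrow> (\<forall>b\<in>F. c b = 0)) \<and>
     (\<forall>p\<in>poly_ring K. \<exists>q\<in>K_span K B. residue_class I p = residue_class I q)"

definition semialg_set ::
  "nat \<Rightarrow> (nat \<Rightarrow> 'n::finite mpoly) \<Rightarrow> nat \<Rightarrow> (nat \<Rightarrow> 'n mpoly) \<Rightarrow> (real ^ 'n) set" where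
  "semialg_set r g s h =
     {\<xi>. (\<forall>i\<in>{1..r}. poly_eval (g i) \<xi> \<ge> 0) \<and> (\<forall>j\<in>{1..s}. poly_eval (h j) \<xi> = 0)}"

end

theory Submission
  imports Defs "HOL-Computational_Algebra.Fundamental_Theorem_Algebra"
begin

text \<open>
  Only the existence of a certificate needs work; evaluating a certificate at a point of \<open>S\<close> gives
  the other direction. Write \<open>A = K[x]/I\<close> and let \<open>V\<close> be the finite set of complex zeros of \<open>I\<close>.

  \<^bold>\<open>Structure of the quotient.\<close> The ring \<open>A\<close> is finite-dimensional and reduced, so each of its elements
  \<open>y\<close> satisfies \<open>y = y\<^sup>2 w\<close> for some \<open>w\<close> (\<open>von_neumann_regular\<close>). In characteristic 0 this makes
  multiplication by any \<open>t\<close> in \<open>K[x]\<close> diagonalizable on the space of \<open>K\<close>-linear functionals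
  \<open>A \<rightarrow> \<complex>\<close>: if \<open>t\<close> had a Jordan block of size 2 with eigenvalue \<open>\<rho>\<close>, regularity of \<open>Q(t)\<close> would give
  \<open>Q'(\<rho>) = 0\<close> for each \<open>Q \<in> K[T]\<close> with \<open>Q(\<rho>) = 0\<close>, so all derivatives of an annihilating polynomial
  of \<open>t\<close> would vanish at \<open>\<rho>\<close>, although one of them is a nonzero constant (\<open>multiplication_semisimple\<close>). Hence every
  functional is a sum of joint eigenvectors of the variables, and those are the multiples of
  evaluations at points of \<open>V\<close> (\<open>functional_combination_of_evaluations\<close>). This says three things at
  once: polynomials vanishing on \<open>V\<close> lie in \<open>I\<close>, the basis \<open>B\<close> stays linearly independent over \<open>\<complex>\<close> as a
  set of functions on \<open>V\<close>, and by interpolation every function on \<open>V\<close> compatible with complex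
  conjugation is a real combination of \<open>B\<close>.

  \<^bold>\<open>The strictly positive case without inequalities.\<close> Let \<open>F \<in> K[x]\<close> be positive at the real points of
  \<open>V\<close>. The real combinations of \<open>B\<close> that are positive there are squares on \<open>V\<close>, and they form an open
  set containing \<open>F\<close>. So, unless \<open>F = 0\<close> in \<open>A\<close>, there are \<open>D\<close> linearly independent squares \<open>s\<^sub>k\<close> of real combinations such that
  \<open>F\<close> has positive coordinates in terms of them (\<open>simplicial_cone_around\<close>). Now move the square roots
  to nearby combinations with coefficients in \<open>K\<close>, which is dense in \<open>\<real>\<close>. The coordinates of \<open>F\<close> stay
  positive, and they lie in \<open>K\<close> because they solve a linear system over \<open>K\<close>
  (\<open>perturbed_simplicial_cone\<close>). Working with a simplicial cone is what bounds the number of squares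
  by \<open>D\<close>.

  \<^bold>\<open>Inequalities and zeros.\<close> If \<open>F > 0\<close> only on \<open>S\<close>, choose \<open>u\<^sub>i\<close> that are nearly 0 where \<open>g\<^sub>i \<ge> 0\<close> and large
  where \<open>g\<^sub>i < 0\<close>; then \<open>F - \<Sum> u\<^sub>i\<^sup>2 g\<^sub>i\<close> is positive at all real points of \<open>V\<close>
  (\<open>certificate_of_positive\<close>). If \<open>f\<close> has zeros on \<open>S\<close>, take \<open>w\<close> with \<open>f = f\<^sup>2 w\<close> in \<open>A\<close>. The idempotent
  \<open>e = f w\<close> is 0 at the zeros of \<open>f\<close> and 1 at the other points of \<open>V\<close>, so \<open>f + 1 - e\<close> is positive
  on \<open>S\<close> and \<open>f = e\<^sup>2 (f + 1 - e)\<close> in \<open>A\<close>. Multiplying a certificate of \<open>f + 1 - e\<close> by \<open>e\<^sup>2\<close>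
  gives one of \<open>f\<close> (\<open>certificate_of_nonnegative\<close>).
\<close>

section \<open>Linear algebra over a field of real numbers\<close>

locale real_field =
  fixes K :: "real set"
  assumes subfield: "real_subfield K"
begin

lemma zero_mem [simp, intro]: "0 \<in> K"
  and one_mem [simp, intro]: "1 \<in> K"
  and add_mem [simp, intro]: "a \<in> K \<Longrightarrow> b \<in> K \<Longrightarrow> a + b \<in> K"
  and mult_mem [simp, intro]: "a \<in> K \<Longrightarrow> b \<in> K \<Longrightarrow> a * b \<in> K"
  and uminus_mem [simp, intro]: "a \<in> K \<Longrightarrow> - a \<in> K"
  and inverse_mem [simp, intro]: "a \<in> K \<Longrightarrow> inverse a \<in> K"
  using subfield unfolding real_subfield_def by blast+

lemma diff_mem [simp, intro]: "a \<in> K \<Longrightarrow> b \<in> K \<Longrightarrow> a - b \<in> K"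
  using add_mem[of a "- b"] by auto

lemma divide_mem [simp, intro]: "a \<in> K \<Longrightarrow> b \<in> K \<Longrightarrow> a / b \<in> K"
  by (auto simp: divide_inverse)

lemma sum_mem: "(\<And>x. x \<in> A \<Longrightarrow> u x \<in> K) \<Longrightarrow> sum u A \<in> K"
  by (induction A rule: infinite_finite_induct) auto

lemma of_nat_mem [simp, intro]: "real n \<in> K"
  by (induction n) auto

lemma of_int_mem [simp, intro]: "real_of_int n \<in> K"
  by (cases n rule: int_cases2) auto

lemma Rats_mem: "x \<in> \<rat> \<Longrightarrow> x \<in> K"
  by (auto elim!: Rats_cases')

lemma approximating_sequence:
  fixes x :: real
  obtains u where "\<And>n :: nat. u n \<in> K" "u \<longlonglongrightarrow> x"
proof -
  have "\<exists>a\<in>K. x < a \<and> a < x + 1 / Suc n" for n :: nat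
    using Rats_dense_in_real[of x "x + 1 / Suc n"] Rats_mem by auto
  then obtain u where u: "\<And>n :: nat. u n \<in> K \<and> x < u n \<and> u n < x + 1 / Suc n"
    by metis
  have "u \<longlonglongrightarrow> x"
  proof (rule tendsto_sandwich)
    show "(\<lambda>n. x) \<longlonglongrightarrow> x" by simp
    show "(\<lambda>n. x + 1 / Suc n) \<longlonglongrightarrow> x"
      using tendsto_add[OF tendsto_const[of x] LIMSEQ_Suc[OF lim_1_over_n]] by simp
  qed (use u in \<open>auto intro!: always_eventually less_imp_le\<close>)
  with u that show thesis by blast
qed

text \<open>
  Gaussian elimination, one equation at a time: since all coefficients are in \<^term>\<open>K\<close>, so is a nontrivial
  solution.
\<close>

lemma homogeneous_system:
  assumes "finite E" "finite U" "card E < card U"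
    and "\<And>e u. e \<in> E \<Longrightarrow> u \<in> U \<Longrightarrow> M e u \<in> K"
  shows "\<exists>x. (\<forall>u\<in>U. x u \<in> K) \<and> (\<exists>u\<in>U. x u \<noteq> 0) \<and> (\<forall>e\<in>E. (\<Sum>u\<in>U. M e u * x u) = 0)"
  using assms
proof (induction E arbitrary: U M rule: finite_induct)
  case empty
  then have "U \<noteq> {}" by auto
  then show ?case by (intro exI[of _ "\<lambda>_. 1"]) auto
next
  case (insert e E)
  show ?case
  proof (cases "\<forall>u\<in>U. M e u = 0")
    case True
    obtain x where "\<forall>u\<in>U. x u \<in> K" "\<exists>u\<in>U. x u \<noteq> 0" "\<forall>e\<in>E. (\<Sum>u\<in>U. M e u * x u) = 0"
      using insert.IH[of U M] insert.prems insert.hyps by auto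
    with True show ?thesis by (intro exI[of _ x]) auto
  next
    case False
    then obtain v where v: "v \<in> U" "M e v \<noteq> 0" by blast
    let ?U = "U - {v}"
    define M' where "M' e' u = M e' u - M e' v * (M e u / M e v)" for e' u
    have "card E < card ?U"
      using insert.prems insert.hyps v by auto
    moreover have "M' e' u \<in> K" if "e' \<in> E" "u \<in> ?U" for e' u
      unfolding M'_def using that insert.prems(3) v by (intro diff_mem mult_mem divide_mem) auto
    ultimately obtain x where x: "\<forall>u\<in>?U. x u \<in> K" "\<exists>u\<in>?U. x u \<noteq> 0"
        "\<forall>e'\<in>E. (\<Sum>u\<in>?U. M' e' u * x u) = 0"
      using insert.IH[of ?U M'] insert.prems(1) by auto
    define c where "c = - (\<Sum>u\<in>?U. M e u * x u) / M e v"
    define y where "y = x(v := c)"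
    have c: "c \<in> K"
      unfolding c_def using v insert.prems(3) x(1) by (intro divide_mem uminus_mem sum_mem) auto
    have split: "(\<Sum>u\<in>U. M e' u * y u) = M e' v * c + (\<Sum>u\<in>?U. M e' u * x u)" for e'
      using v insert.prems(1) by (auto simp: sum.remove[of U v] y_def intro!: sum.cong)
    have "(\<Sum>u\<in>U. M e' u * y u) = 0" if "e' \<in> E" for e'
    proof -
      have "0 = (\<Sum>u\<in>?U. M e' u * x u - M e' v / M e v * (M e u * x u))"
        using x(3) that by (auto simp: M'_def algebra_simps)
      also have "\<dots> = (\<Sum>u\<in>?U. M e' u * x u) + M e' v * c"
        by (simp add: sum_subtractf sum_distrib_left[symmetric] sum_divide_distrib[symmetric] c_def)
      finally show ?thesis by (simp add: split)
    qed
    moreover have "(\<Sum>u\<in>U. M e u * y u) = 0"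
      using v by (simp add: split c_def)
    ultimately show ?thesis
      using c x(1,2) by (intro exI[of _ y]) (auto simp: y_def)
  qed
qed

text \<open>
  The vectors \<^term>\<open>s l\<close> span a simplicial cone with dual basis \<^term>\<open>\<tau>\<close>, and \<^term>\<open>\<phi>\<close> lies in its interior.
  Among the \<^term>\<open>card B + 1\<close> vectors \<^term>\<open>\<phi>\<close> and \<^term>\<open>s' l\<close> there is a linear relation over \<^term>\<open>K\<close>. Reading
  it through \<^term>\<open>\<tau>\<close> shows, for small perturbations, that \<^term>\<open>\<phi>\<close> occurs in it and that after
  normalization the coefficients of the \<^term>\<open>s' l\<close> are close to the positive numbers
  \<^term>\<open>\<Sum>b\<in>B. \<tau> k b * \<phi> b\<close>.
\<close>

lemma perturbed_simplicial_cone: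
  fixes s \<tau> :: "'b \<Rightarrow> 'b \<Rightarrow> real" and \<phi> :: "'b \<Rightarrow> real"
  assumes B: "finite B" "B \<noteq> {}"
    and dual: "\<And>k l. k \<in> B \<Longrightarrow> l \<in> B \<Longrightarrow> (\<Sum>b\<in>B. \<tau> k b * s l b) = (if k = l then 1 else 0)"
    and pos: "\<And>k. k \<in> B \<Longrightarrow> (\<Sum>b\<in>B. \<tau> k b * \<phi> b) > 0"
    and \<phi>: "\<And>b. b \<in> B \<Longrightarrow> \<phi> b \<in> K"
  shows "\<exists>\<epsilon>>0. \<forall>s'. (\<forall>l\<in>B. \<forall>b\<in>B. s' l b \<in> K \<and> \<bar>s' l b - s l b\<bar> < \<epsilon>) \<longrightarrow>
           (\<exists>x. (\<forall>l\<in>B. x l \<in> K \<and> 0 \<le> x l) \<and> (\<forall>b\<in>B. \<phi> b = (\<Sum>l\<in>B. x l * s' l b)))"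
proof -
  define p where "p k = (\<Sum>b\<in>B. \<tau> k b * \<phi> b)" for k
  define m where "m = Min (p ` B)"
  define P where "P = (\<Sum>k\<in>B. p k)"
  define N where "N = real (card B)"
  define A where "A = (\<Sum>k\<in>B. \<Sum>b\<in>B. \<bar>\<tau> k b\<bar>) + 1"
  have N: "N \<ge> 1"
    using B by (simp add: N_def Suc_le_eq card_gt_0_iff)
  have m: "m > 0" "\<And>k. k \<in> B \<Longrightarrow> m \<le> p k"
    using B pos by (auto simp: m_def p_def)
  have P: "P > 0"
    unfolding P_def using B pos by (intro sum_pos) (auto simp: p_def)
  have A: "A \<ge> 1"
    unfolding A_def by (simp add: sum_nonneg)
  \<comment> \<open>An error of at most \<open>\<eta>\<close> in each dual coordinate of each \<open>s' l\<close> perturbs the coefficients of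
    \<open>\<phi>\<close> by at most \<open>\<eta> * (2 * P)\<close>, hence by at most their minimum \<open>m\<close>.\<close>
  define \<eta> where "\<eta> = min (1 / (2 * N)) (m / (2 * P))"
  have \<eta>: "\<eta> > 0" "N * \<eta> \<le> 1 / 2" "\<eta> * (2 * P) \<le> m"
  proof -
    show "\<eta> > 0" using N m P by (auto simp: \<eta>_def)
    have "\<eta> \<le> 1 / (2 * N)" "\<eta> \<le> m / (2 * P)" by (auto simp: \<eta>_def)
    then show "N * \<eta> \<le> 1 / 2" "\<eta> * (2 * P) \<le> m" using N P by (auto simp: field_simps)
  qed
  show ?thesis
  proof (intro exI[of _ "\<eta> / A"] conjI allI impI)
    show "\<eta> / A > 0" using \<eta> A by simp
    fix s' assume s': "\<forall>l\<in>B. \<forall>b\<in>B. s' l b \<in> K \<and> \<bar>s' l b - s l b\<bar> < \<eta> / A"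
    define d where "d k l = (\<Sum>b\<in>B. \<tau> k b * (s' l b - s l b))" for k l
    have d: "\<bar>d k l\<bar> \<le> \<eta>" if "k \<in> B" "l \<in> B" for k l
    proof -
      have "\<bar>d k l\<bar> \<le> (\<Sum>b\<in>B. \<bar>\<tau> k b\<bar> * (\<eta> / A))"
        unfolding d_def using s' that
        by (intro order.trans[OF sum_abs] sum_mono) (simp only: abs_mult, intro mult_left_mono, auto simp: less_imp_le)
      also have "\<dots> = (\<Sum>b\<in>B. \<bar>\<tau> k b\<bar>) * (\<eta> / A)"
        by (simp only: sum_distrib_right)
      also have "(\<Sum>b\<in>B. \<bar>\<tau> k b\<bar>) \<le> (\<Sum>k\<in>B. \<Sum>b\<in>B. \<bar>\<tau> k b\<bar>)"
        using that B by (intro member_le_sum) (auto intro: sum_nonneg)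
      then have "(\<Sum>b\<in>B. \<bar>\<tau> k b\<bar>) * (\<eta> / A) \<le> A * (\<eta> / A)"
        using \<eta> A by (intro mult_right_mono) (auto simp: A_def)
      also have "\<dots> = \<eta>" using A by simp
      finally show ?thesis .
    qed
    \<comment> \<open>The \<^term>\<open>card B + 1\<close> vectors \<^term>\<open>\<phi>\<close> (index \<^term>\<open>None\<close>) and \<^term>\<open>s' l\<close> (index \<^term>\<open>Some l\<close>) are dependent over \<^term>\<open>K\<close>.\<close>
    have "\<exists>x. (\<forall>u\<in>insert None (Some ` B). x u \<in> K) \<and> (\<exists>u\<in>insert None (Some ` B). x u \<noteq> 0) \<and>
        (\<forall>b\<in>B. (\<Sum>u\<in>insert None (Some ` B). (case u of None \<Rightarrow> - \<phi> b | Some l \<Rightarrow> s' l b) * x u) = 0)"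
      using B s' uminus_mem[OF \<phi>] by (intro homogeneous_system) (auto simp: card_image)
    then obtain x where X: "\<forall>u\<in>insert None (Some ` B). x u \<in> K" "\<exists>u\<in>insert None (Some ` B). x u \<noteq> 0"
        "\<forall>b\<in>B. (\<Sum>u\<in>insert None (Some ` B). (case u of None \<Rightarrow> - \<phi> b | Some l \<Rightarrow> s' l b) * x u) = 0"
      by blast
    have x: "x None \<in> K" "\<And>l. l \<in> B \<Longrightarrow> x (Some l) \<in> K"
        "x None \<noteq> 0 \<or> (\<exists>l\<in>B. x (Some l) \<noteq> 0)"
        "\<And>b. b \<in> B \<Longrightarrow> x None * \<phi> b = (\<Sum>l\<in>B. x (Some l) * s' l b)"
      using B X by (auto simp: sum.reindex o_def mult.commute)
    define y where "y l = x (Some l)" for l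
    have rel: "x None * p k = y k + (\<Sum>l\<in>B. y l * d k l)" if k: "k \<in> B" for k
    proof -
      have "x None * p k = (\<Sum>b\<in>B. \<tau> k b * (\<Sum>l\<in>B. y l * s' l b))"
        unfolding p_def sum_distrib_left[of "x None"] y_def
        by (intro sum.cong refl) (simp only: mult.left_commute[of "x None"] x(4))
      also have "\<dots> = (\<Sum>l\<in>B. y l * (\<Sum>b\<in>B. \<tau> k b * s' l b))"
        unfolding sum_distrib_left by (subst sum.swap) (auto simp: algebra_simps)
      also have "\<dots> = (\<Sum>l\<in>B. y l * (if k = l then 1 else 0) + y l * d k l)"
        using dual k by (intro sum.cong refl)
          (auto simp: d_def algebra_simps sum_subtractf sum_distrib_left simp flip: sum.distrib)
      also have "\<dots> = y k + (\<Sum>l\<in>B. y l * d k l)"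
        using B k by (simp add: sum.distrib if_distrib[of "(*) _"] cong: if_cong)
      finally show ?thesis .
    qed
    define Y where "Y = (\<Sum>l\<in>B. \<bar>y l\<bar>)"
    have Yd: "\<bar>\<Sum>l\<in>B. y l * d k l\<bar> \<le> \<eta> * Y" if k: "k \<in> B" for k
    proof -
      have "\<bar>\<Sum>l\<in>B. y l * d k l\<bar> \<le> (\<Sum>l\<in>B. \<bar>y l\<bar> * \<eta>)"
        using d k by (intro order.trans[OF sum_abs] sum_mono) (auto simp: abs_mult intro!: mult_left_mono)
      then show ?thesis by (simp add: Y_def sum_distrib_left mult.commute)
    qed
    have "Y \<le> (\<Sum>k\<in>B. \<bar>x None\<bar> * p k + \<eta> * Y)"
      unfolding Y_def
    proof (rule sum_mono)
      fix k assume k: "k \<in> B"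
      have "\<bar>y k\<bar> = \<bar>x None * p k - (\<Sum>l\<in>B. y l * d k l)\<bar>"
        using rel[OF k] by simp
      also have "\<dots> \<le> \<bar>x None\<bar> * p k + \<eta> * Y"
        using Yd[OF k] m k by (auto simp: abs_mult intro!: order.trans[OF abs_triangle_ineq4] add_mono)
           (metis abs_of_pos order_less_le_trans order_refl)
      finally show "\<bar>y k\<bar> \<le> \<bar>x None\<bar> * p k + \<eta> * (\<Sum>l\<in>B. \<bar>y l\<bar>)"
        by (simp add: Y_def)
    qed
    also have "\<dots> = \<bar>x None\<bar> * P + N * \<eta> * Y"
      by (simp add: sum.distrib sum_distrib_left P_def N_def)
    also have "\<dots> \<le> \<bar>x None\<bar> * P + 1 / 2 * Y"
      using \<eta> by (intro add_left_mono mult_right_mono) (auto simp: Y_def sum_nonneg)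
    finally have Y: "Y \<le> 2 * \<bar>x None\<bar> * P" by simp
    have x0: "x None \<noteq> 0"
    proof
      assume 0: "x None = 0"
      then have "(\<Sum>l\<in>B. \<bar>y l\<bar>) = 0"
        using Y by (intro antisym sum_nonneg) (auto simp: Y_def)
      then show False
        using B x(3) 0 by (auto simp: y_def sum_nonneg_eq_0_iff)
    qed
    show "\<exists>x. (\<forall>l\<in>B. x l \<in> K \<and> 0 \<le> x l) \<and> (\<forall>b\<in>B. \<phi> b = (\<Sum>l\<in>B. x l * s' l b))"
    proof (intro exI[of _ "\<lambda>l. y l / x None"] conjI ballI)
      fix k assume k: "k \<in> B"
      show "y k / x None \<in> K" using x k by (auto simp: y_def)
      have "y k / x None = p k - (\<Sum>l\<in>B. y l * d k l) / x None"
        using rel[OF k] x0 by (simp add: field_simps)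
      moreover have "\<bar>(\<Sum>l\<in>B. y l * d k l) / x None\<bar> \<le> \<eta> * (2 * P)"
      proof -
        have "\<bar>\<Sum>l\<in>B. y l * d k l\<bar> \<le> \<eta> * (2 * \<bar>x None\<bar> * P)"
          using Yd[OF k] Y \<eta> by (meson mult_left_mono less_imp_le order_trans)
        then show ?thesis using x0 by (simp add: abs_divide field_simps)
      qed
      ultimately show "0 \<le> y k / x None" using \<eta>(3) m(2)[OF k] by linarith
    next
      fix b assume "b \<in> B"
      then show "\<phi> b = (\<Sum>l\<in>B. y l / x None * s' l b)"
        using x(4) x0 by (simp add: y_def sum_divide_distrib[symmetric] field_simps)
    qed
  qed
qed

end

section \<open>Polynomials and their values\<close>

abbreviation lookup where "lookup \<equiv> Poly_Mapping.lookup"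
abbreviation single where "single \<equiv> Poly_Mapping.single"
abbreviation keys where "keys \<equiv> Poly_Mapping.keys"

lemma sum_of_terms: "p = (\<Sum>m\<in>keys p. single m (lookup p m))"
  by (intro poly_mapping_eqI) (auto simp: lookup_sum lookup_single when_def in_keys_iff)

definition mon_eval :: "('n::finite \<Rightarrow>\<^sub>0 nat) \<Rightarrow> 'a::comm_ring_1 ^ 'n \<Rightarrow> 'a" where
  "mon_eval m x = (\<Prod>i\<in>UNIV. (x $ i) ^ lookup m i)"

lemma mon_eval_add: "mon_eval (m + n) x = mon_eval m x * mon_eval n x"
  by (simp add: mon_eval_def lookup_add power_add prod.distrib)

lemma poly_eval_superset:
  assumes "finite A" "keys p \<subseteq> A"
  shows "poly_eval p x = (\<Sum>m\<in>A. of_real (lookup p m) * mon_eval m x)"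
  unfolding poly_eval_def mon_eval_def using assms
  by (intro sum.mono_neutral_left) (auto simp: in_keys_iff)

lemma poly_eval_single: "poly_eval (single m c) x = of_real c * mon_eval m x"
  by (subst poly_eval_superset[of "{m}"]) auto

lemma poly_eval_add: "poly_eval (p + q) x = poly_eval p x + poly_eval q x"
  using keys_add[of p q]
  by (simp add: poly_eval_superset[of "keys p \<union> keys q"] lookup_add sum.distrib algebra_simps)

lemma poly_eval_zero [simp]: "poly_eval 0 x = 0"
  by (simp add: poly_eval_def)

lemma poly_eval_sum: "poly_eval (sum u A) x = (\<Sum>a\<in>A. poly_eval (u a) x)"
  by (induction A rule: infinite_finite_induct) (auto simp: poly_eval_add)

lemma poly_eval_mult: "poly_eval (p * q) x = poly_eval p x * poly_eval q x"
proof -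
  have "p * q = (\<Sum>m\<in>keys p. \<Sum>n\<in>keys q. single (m + n) (lookup p m * lookup q n))"
    by (subst (1) sum_of_terms[of p], subst (1) sum_of_terms[of q])
      (simp add: sum_product mult_single)
  then have "poly_eval (p * q) x =
      (\<Sum>m\<in>keys p. \<Sum>n\<in>keys q. (of_real (lookup p m) * mon_eval m x) * (of_real (lookup q n) * mon_eval n x))"
    by (simp add: poly_eval_sum poly_eval_single mon_eval_add mult_ac)
  then show ?thesis
    by (simp add: sum_product[symmetric] poly_eval_superset[of "keys p" p] poly_eval_superset[of "keys q" q])
qed

lemma poly_eval_Const [simp]: "poly_eval (Const c) x = of_real c"
  by (simp add: Const_def poly_eval_single mon_eval_def)

lemma poly_eval_one [simp]: "poly_eval 1 x = 1"
  using poly_eval_Const[of 1 x] by (simp add: Const_def)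

lemma poly_eval_uminus: "poly_eval (- p) x = - poly_eval p x"
  using poly_eval_add[of p "- p" x] by (simp add: eq_neg_iff_add_eq_0 add.commute)

lemma poly_eval_diff: "poly_eval (p - q) x = poly_eval p x - poly_eval q x"
  using poly_eval_add[of p "- q" x] by (simp add: poly_eval_uminus)

lemma poly_eval_power: "poly_eval (p ^ k) x = poly_eval p x ^ k"
  by (induction k) (auto simp: poly_eval_mult)

lemmas poly_eval_ring_hom =
  poly_eval_add poly_eval_diff poly_eval_uminus poly_eval_mult poly_eval_power poly_eval_sum

definition variable :: "'n \<Rightarrow> 'n mpoly" where
  "variable i = single (single i 1) 1"

lemma poly_eval_variable [simp]: "poly_eval (variable i) x = x $ i"
proof -
  have "mon_eval (single i 1) x = (\<Prod>j\<in>UNIV. if j = i then x $ i else 1)"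
    unfolding mon_eval_def by (intro prod.cong) (auto simp: lookup_single when_def)
  then show ?thesis by (simp add: variable_def poly_eval_single)
qed

lemma monomial_eq_prod_variables: "single m 1 = (\<Prod>i\<in>UNIV. variable i ^ lookup m i)"
  for m :: "'n::finite \<Rightarrow>\<^sub>0 nat"
proof -
  have pow: "variable i ^ k = single (single i k) 1" for i :: 'n and k
    by (induction k) (auto simp: variable_def mult_single simp flip: single_add)
  have "(\<Prod>i\<in>A. single (u i) 1) = single (\<Sum>i\<in>A. u i) (1 :: real)"
    for A :: "'n set" and u :: "'n \<Rightarrow> 'n \<Rightarrow>\<^sub>0 nat"
    by (induction A rule: infinite_finite_induct) (auto simp: mult_single)
  moreover have "m = (\<Sum>i\<in>UNIV. single i (lookup m i))"
    by (intro poly_mapping_eqI) (auto simp: lookup_sum lookup_single when_def)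
  ultimately show ?thesis by (simp add: pow)
qed

lemma Const_add: "Const (a + b) = Const a + Const b"
  and Const_mult: "Const (a * b) = Const a * Const b"
  and Const_0 [simp]: "Const 0 = 0"
  and Const_1 [simp]: "Const 1 = 1"
  and Const_uminus: "Const (- a) = - Const a"
  and Const_diff: "Const (a - b) = Const a - Const b"
  by (simp_all add: Const_def single_add mult_single single_uminus single_diff)

definition complexify :: "real ^ 'n \<Rightarrow> complex ^ 'n" where
  "complexify x = (\<chi> i. of_real (x $ i))"

lemma inj_complexify: "inj complexify"
  by (auto simp: inj_def complexify_def vec_eq_iff)

definition conj_point :: "complex ^ 'n \<Rightarrow> complex ^ 'n" where
  "conj_point z = (\<chi> i. cnj (z $ i))"

lemma poly_eval_complexify: "poly_eval p (complexify x) = of_real (poly_eval p x)"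
  by (simp add: poly_eval_def complexify_def)

lemma poly_eval_conj_point: "poly_eval p (conj_point z) = cnj (poly_eval p z)"
  by (simp add: poly_eval_def conj_point_def)

lemma conj_point_involution [simp]: "conj_point (conj_point z) = z"
  by (simp add: conj_point_def vec_eq_iff)

lemma conj_point_fixed_iff: "conj_point z = z \<longleftrightarrow> z \<in> range complexify"
proof
  assume *: "conj_point z = z"
  have "z = complexify (\<chi> i. Re (z $ i))"
    using * by (auto simp: vec_eq_iff conj_point_def complexify_def complex_eq_iff)
  then show "z \<in> range complexify" by blast
qed (auto simp: conj_point_def complexify_def)

context real_field
begin

abbreviation R :: "'n mpoly set" where "R \<equiv> poly_ring K"

lemma single_in [simp, intro]: "c \<in> K \<Longrightarrow> single m c \<in> R"
  by (auto simp: poly_ring_def lookup_single when_def)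

lemma Const_in [simp, intro]: "c \<in> K \<Longrightarrow> Const c \<in> R"
  by (auto simp: Const_def)

lemma zero_in [simp, intro]: "0 \<in> R"
  and one_in [simp, intro]: "1 \<in> R"
  and variable_in [simp, intro]: "variable i \<in> R"
  using Const_in[of 0] Const_in[of 1] by (auto simp: variable_def)

lemma add_in [simp, intro]: "p \<in> R \<Longrightarrow> q \<in> R \<Longrightarrow> p + q \<in> R"
  and uminus_in [simp, intro]: "p \<in> R \<Longrightarrow> - p \<in> R"
  and diff_in [simp, intro]: "p \<in> R \<Longrightarrow> q \<in> R \<Longrightarrow> p - q \<in> R"
  by (auto simp: poly_ring_def lookup_add lookup_minus)

lemma sum_in: "(\<And>a. a \<in> A \<Longrightarrow> u a \<in> R) \<Longrightarrow> sum u A \<in> R"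
  by (induction A rule: infinite_finite_induct) auto

lemma mult_in [simp, intro]: "p * q \<in> R" if "p \<in> R" "q \<in> R"
proof -
  have "p * q = (\<Sum>m\<in>keys p. \<Sum>n\<in>keys q. single (m + n) (lookup p m * lookup q n))"
    by (subst (1) sum_of_terms[of p], subst (1) sum_of_terms[of q])
      (simp add: sum_product mult_single)
  also have "\<dots> \<in> R"
    using that by (intro sum_in single_in mult_mem) (auto simp: poly_ring_def)
  finally show ?thesis .
qed

lemma power_in [simp, intro]: "p \<in> R \<Longrightarrow> p ^ k \<in> R"
  by (induction k) auto

lemma prod_in: "(\<And>a. a \<in> A \<Longrightarrow> u a \<in> R) \<Longrightarrow> prod u A \<in> R"
  by (induction A rule: infinite_finite_induct) auto

end

section \<open>Coordinates in the quotient ring\<close>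

text \<open>
  The quotient itself is never formed: its elements are handled through representatives in
  \<^term>\<open>R\<close> and their coordinates with respect to \<^term>\<open>B\<close>.
\<close>

locale finite_quotient = real_field +
  fixes I B :: "'n::finite mpoly set"
  assumes ideal_subset: "I \<subseteq> R"
    and ideal_zero: "0 \<in> I"
    and ideal_add: "a \<in> I \<Longrightarrow> b \<in> I \<Longrightarrow> a + b \<in> I"
    and ideal_mult: "p \<in> R \<Longrightarrow> a \<in> I \<Longrightarrow> p * a \<in> I"
    and radical: "p \<in> R \<Longrightarrow> p ^ m \<in> I \<Longrightarrow> m \<ge> 1 \<Longrightarrow> p \<in> I"
    and finite_zeros: "finite {z :: complex ^ 'n. \<forall>p\<in>I. poly_eval p z = 0}"
    and finite_basis: "finite B"
    and basis_subset: "B \<subseteq> R"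
    and basis_spans: "p \<in> R \<Longrightarrow> \<exists>c. (\<forall>b\<in>B. c b \<in> K) \<and> p - (\<Sum>b\<in>B. Const (c b) * b) \<in> I"
    and basis_independent:
      "(\<And>b. b \<in> B \<Longrightarrow> c b \<in> K) \<Longrightarrow> (\<Sum>b\<in>B. Const (c b) * b) \<in> I \<Longrightarrow> b \<in> B \<Longrightarrow> c b = 0"
begin

lemma ideal_uminus: "a \<in> I \<Longrightarrow> - a \<in> I"
  using ideal_mult[of "Const (- 1)" a] Const_in[of "- 1"] by (simp add: Const_uminus uminus_mem)

lemma ideal_diff: "a \<in> I \<Longrightarrow> b \<in> I \<Longrightarrow> a - b \<in> I"
  using ideal_add[of a "- b"] by (simp add: ideal_uminus)

lemma ideal_sum: "(\<And>x. x \<in> A \<Longrightarrow> u x \<in> I) \<Longrightarrow> sum u A \<in> I"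
  by (induction A rule: infinite_finite_induct) (auto simp: ideal_zero ideal_add)

definition combination :: "('n mpoly \<Rightarrow> real) \<Rightarrow> 'n mpoly" where
  "combination c = (\<Sum>b\<in>B. Const (c b) * b)"

lemma combination_in: "(\<And>b. b \<in> B \<Longrightarrow> c b \<in> K) \<Longrightarrow> combination c \<in> R"
  unfolding combination_def using basis_subset by (intro sum_in mult_in) auto

definition coord :: "'n mpoly \<Rightarrow> 'n mpoly \<Rightarrow> real" where
  "coord p = (SOME c. (\<forall>b\<in>B. c b \<in> K) \<and> p - combination c \<in> I)"

lemma coord_mem: "p \<in> R \<Longrightarrow> b \<in> B \<Longrightarrow> coord p b \<in> K"
  and coord_expand: "p \<in> R \<Longrightarrow> p - combination (coord p) \<in> I"
  unfolding coord_def combination_def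
  using someI_ex[OF basis_spans[of p]] by blast+

lemma coord_unique:
  assumes "p \<in> R" "\<And>b. b \<in> B \<Longrightarrow> c b \<in> K" "p - combination c \<in> I" "b \<in> B"
  shows "coord p b = c b"
proof -
  have "(p - combination c) - (p - combination (coord p)) \<in> I"
    using assms(3) coord_expand[OF assms(1)] by (rule ideal_diff)
  then have "(\<Sum>b\<in>B. Const (coord p b - c b) * b) \<in> I"
    by (simp add: combination_def Const_diff algebra_simps sum_subtractf)
  then show ?thesis
    using basis_independent[of "\<lambda>b. coord p b - c b" b] assms coord_mem by auto
qed

lemma coord_add:
  assumes "p \<in> R" "q \<in> R" "b \<in> B"
  shows "coord (p + q) b = coord p b + coord q b"
proof (rule coord_unique)
  have "(p - combination (coord p)) + (q - combination (coord q)) \<in> I"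
    using assms coord_expand ideal_add by blast
  then show "p + q - combination (\<lambda>b. coord p b + coord q b) \<in> I"
    by (simp add: combination_def Const_add algebra_simps sum.distrib)
qed (use assms coord_mem in auto)

lemma coord_scale:
  assumes "c \<in> K" "p \<in> R" "b \<in> B"
  shows "coord (Const c * p) b = c * coord p b"
proof (rule coord_unique)
  have "Const c * (p - combination (coord p)) \<in> I"
    using assms coord_expand ideal_mult by blast
  then show "Const c * p - combination (\<lambda>b. c * coord p b) \<in> I"
    by (simp add: combination_def Const_mult algebra_simps sum_distrib_left)
qed (use assms coord_mem in auto)

lemma coord_ideal: "p \<in> I \<Longrightarrow> b \<in> B \<Longrightarrow> coord p b = 0"
  using coord_unique[of p "\<lambda>_. 0" b] ideal_subset by (auto simp: combination_def)

lemma coord_basis: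
  assumes "b \<in> B" "b' \<in> B"
  shows "coord b b' = (if b = b' then 1 else 0)"
proof (rule coord_unique)
  have "combination (\<lambda>b'. if b = b' then 1 else 0) = (\<Sum>b'\<in>B. if b = b' then b' else 0)"
    unfolding combination_def by (intro sum.cong) auto
  then show "b - combination (\<lambda>b'. if b = b' then 1 else 0) \<in> I"
    using assms finite_basis by (simp add: ideal_zero)
qed (use assms basis_subset in auto)

lemma algebraic_relation:
  assumes t: "t \<in> R"
  shows "\<exists>N c. (\<forall>k\<le>N. c k \<in> K) \<and> (\<exists>k\<le>N. c k \<noteq> 0) \<and> (\<Sum>k\<le>N. Const (c k) * t ^ k) \<in> I"
proof -
  have "\<exists>c. (\<forall>k\<in>{..card B}. c k \<in> K) \<and> (\<exists>k\<in>{..card B}. c k \<noteq> 0) \<and>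
      (\<forall>b\<in>B. (\<Sum>k\<in>{..card B}. coord (t ^ k) b * c k) = 0)"
    using finite_basis t by (intro homogeneous_system coord_mem) auto
  then obtain c where c: "\<forall>k\<le>card B. c k \<in> K" "\<exists>k\<le>card B. c k \<noteq> 0"
      "\<And>b. b \<in> B \<Longrightarrow> (\<Sum>k\<le>card B. coord (t ^ k) b * c k) = 0"
    by auto
  have "(\<Sum>k\<le>card B. Const (c k) * (t ^ k - combination (coord (t ^ k)))) \<in> I"
    using t c(1) by (intro ideal_sum ideal_mult coord_expand) auto
  moreover have "(\<Sum>k\<le>card B. Const (c k) * combination (coord (t ^ k))) =
      (\<Sum>b\<in>B. Const (\<Sum>k\<le>card B. coord (t ^ k) b * c k) * b)"
  proof -
    have Const_sum: "Const (sum u A) = (\<Sum>a\<in>A. Const (u a))" for u :: "nat \<Rightarrow> real" and A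
      by (induction A rule: infinite_finite_induct) (auto simp: Const_add)
    show ?thesis
      by (simp add: combination_def sum_distrib_left sum_distrib_right Const_sum Const_mult
          mult_ac sum.swap[of _ B])
  qed
  ultimately have "(\<Sum>k\<le>card B. Const (c k) * t ^ k) \<in> I"
    using c(3) by (simp add: right_diff_distrib sum_subtractf)
  with c show ?thesis by blast
qed

text \<open>
  A relation \<open>\<Sum> c\<^sub>k y\<^sup>k = 0\<close> in the quotient whose lowest nonzero coefficient has index \<open>k\<^sub>0\<close> can be solved for
  the lowest power, \<open>y ^ k\<^sub>0 = y ^ (k\<^sub>0 + 1) w\<close>. Then \<open>y (1 - y w)\<close> is nilpotent, hence 0 in the quotient
  of a radical ideal.
\<close>

lemma von_neumann_regular:
  assumes y: "y \<in> R"
  shows "\<exists>w\<in>R. y - y\<^sup>2 * w \<in> I"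
proof -
  obtain N c where c: "\<forall>k\<le>N. c k \<in> K" "\<exists>k\<le>N. c k \<noteq> 0" "(\<Sum>k\<le>N. Const (c k) * y ^ k) \<in> I"
    using algebraic_relation[OF y] by blast
  define k0 where "k0 = (LEAST k. k \<le> N \<and> c k \<noteq> 0)"
  have k0: "k0 \<le> N" "c k0 \<noteq> 0"
    using LeastI_ex[OF c(2)] by (auto simp: k0_def)
  have below: "c k = 0" if "k < k0" for k
    using not_less_Least[of k "\<lambda>k. k \<le> N \<and> c k \<noteq> 0"] that k0 by (auto simp: k0_def)
  define w where "w = (\<Sum>k\<in>{k0<..N}. Const (- c k / c k0) * y ^ (k - Suc k0))"
  have w: "w \<in> R"
    unfolding w_def using c(1) k0 y by (intro sum_in mult_in Const_in divide_mem uminus_mem) auto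
  have "(\<Sum>k\<le>N. Const (c k) * y ^ k) = (\<Sum>k\<in>{k0..N}. Const (c k) * y ^ k)"
    using below by (intro sum.mono_neutral_right) (auto simp: not_le)
  also have "\<dots> = Const (c k0) * y ^ k0 + (\<Sum>k\<in>{k0<..N}. Const (c k) * y ^ k)"
    using k0 by (subst sum.head) auto
  also have "(\<Sum>k\<in>{k0<..N}. Const (c k) * y ^ k) = - Const (c k0) * y ^ Suc k0 * w"
    unfolding w_def sum_distrib_left
  proof (rule sum.cong)
    fix k assume k: "k \<in> {k0<..N}"
    then have "y ^ k = y ^ Suc k0 * y ^ (k - Suc k0)"
      by (simp flip: power_add power_Suc)
    moreover have "Const (c k) = - Const (c k0) * Const (- c k / c k0)"
      using k0 by (simp flip: Const_mult Const_uminus)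
    ultimately have "Const (c k) * y ^ k =
        (- Const (c k0) * Const (- c k / c k0)) * (y ^ Suc k0 * y ^ (k - Suc k0))"
      by (rule_tac arg_cong2[of _ _ _ _ "(*)"])
    then show "Const (c k) * y ^ k =
        - Const (c k0) * y ^ Suc k0 * (Const (- c k / c k0) * y ^ (k - Suc k0))"
      by (simp only: mult_ac)
  qed simp
  also have "Const (c k0) * y ^ k0 + - Const (c k0) * y ^ Suc k0 * w =
      Const (c k0) * (y ^ k0 * (1 - y * w))"
    by (simp add: algebra_simps)
  finally have "Const (c k0) * (y ^ k0 * (1 - y * w)) \<in> I"
    using c(3) by simp
  then have "Const (inverse (c k0)) * (Const (c k0) * (y ^ k0 * (1 - y * w))) \<in> I"
    using c(1) k0 by (rule_tac ideal_mult) auto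
  moreover have "Const (inverse (c k0)) * (Const (c k0) * q) = q" for q :: "'n mpoly"
    using k0 by (simp add: mult.assoc[symmetric] Const_mult[symmetric])
  ultimately have "y ^ k0 * (1 - y * w) \<in> I" by simp
  then have "y * (1 - y * w) ^ k0 * (y ^ k0 * (1 - y * w)) \<in> I"
    using y w by (rule_tac ideal_mult) auto
  also have "y * (1 - y * w) ^ k0 * (y ^ k0 * (1 - y * w)) = (y - y\<^sup>2 * w) ^ Suc k0"
  proof -
    have "y - y\<^sup>2 * w = y * (1 - y * w)" by (simp add: algebra_simps power2_eq_square)
    then show ?thesis by (simp only: power_mult_distrib power_Suc mult_ac)
  qed
  finally have "y - y\<^sup>2 * w \<in> I"
    using y w by (rule_tac radical[of _ "Suc k0"]) auto
  with w show ?thesis by blast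
qed

end

section \<open>Functionals on the quotient\<close>

context finite_quotient
begin

definition zeros :: "(complex ^ 'n) set" where
  "zeros = {z. \<forall>p\<in>I. poly_eval p z = 0}"

text \<open>
  The linear functionals \<open>K[x]/I \<rightarrow> \<complex>\<close>, as functions of representatives. Values outside \<^term>\<open>R\<close> are
  arbitrary, so functionals are only ever compared on \<^term>\<open>R\<close>.
\<close>

definition functional :: "('n mpoly \<Rightarrow> complex) \<Rightarrow> bool" where
  "functional L \<longleftrightarrow> (\<forall>p\<in>R. \<forall>q\<in>R. L (p + q) = L p + L q) \<and>
     (\<forall>c\<in>K. \<forall>p\<in>R. L (Const c * p) = of_real c * L p) \<and> (\<forall>p\<in>I. L p = 0)"

lemma functional_add: "functional L \<Longrightarrow> p \<in> R \<Longrightarrow> q \<in> R \<Longrightarrow> L (p + q) = L p + L q"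
  and functional_scale: "functional L \<Longrightarrow> c \<in> K \<Longrightarrow> p \<in> R \<Longrightarrow> L (Const c * p) = of_real c * L p"
  and functional_ideal: "functional L \<Longrightarrow> p \<in> I \<Longrightarrow> L p = 0"
  by (auto simp: functional_def)

lemma functional_sum:
  "functional L \<Longrightarrow> (\<And>a. a \<in> A \<Longrightarrow> u a \<in> R) \<Longrightarrow> L (sum u A) = (\<Sum>a\<in>A. L (u a))"
  using functional_ideal[of L 0] ideal_zero
  by (induction A rule: infinite_finite_induct) (auto simp: functional_add sum_in)

lemma functional_cong_ideal:
  assumes L: "functional L" and "p - q \<in> I" "p \<in> R" "q \<in> R"
  shows "L p = L q"
  using functional_add[OF L, of "p - q" q] functional_ideal[OF L, of "p - q"] assms by auto

lemma functional_linear: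
  "functional L \<Longrightarrow> functional L' \<Longrightarrow> functional (\<lambda>p. a * L p + c * L' p)"
  by (auto simp: functional_def algebra_simps)

lemma functional_shift:
  assumes "functional L" "t \<in> R"
  shows "functional (\<lambda>p. L (t * p))"
  using assms ideal_mult by (auto simp: functional_def distrib_left mult.left_commute[of t])

lemma functional_coord: "b \<in> B \<Longrightarrow> functional (\<lambda>p. complex_of_real (coord p b))"
  by (auto simp: functional_def coord_add coord_scale coord_ideal)

text \<open>
  Univariate polynomials over \<^term>\<open>K\<close> are represented by complex polynomials, because their roots are
  needed.
\<close>

definition over_K :: "complex poly \<Rightarrow> bool" where
  "over_K Q \<longleftrightarrow> (\<forall>k. coeff Q k \<in> of_real ` K)"

definition subst_poly :: "complex poly \<Rightarrow> 'n mpoly \<Rightarrow> 'n mpoly" where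
  "subst_poly Q t = (\<Sum>k\<le>degree Q. Const (Re (coeff Q k)) * t ^ k)"

lemma over_K_coeff: "over_K Q \<Longrightarrow> Re (coeff Q k) \<in> K" "over_K Q \<Longrightarrow> of_real (Re (coeff Q k)) = coeff Q k"
  unfolding over_K_def by (metis Re_complex_of_real image_iff)+

lemma over_K_pderiv: "over_K Q \<Longrightarrow> over_K (pderiv Q)"
  unfolding over_K_def
proof
  fix k assume "\<forall>k. coeff Q k \<in> of_real ` K"
  then obtain a where "a \<in> K" "coeff Q (Suc k) = of_real a" by blast
  then have "real (Suc k) * a \<in> K" "coeff (pderiv Q) k = of_real (real (Suc k) * a)"
    by (auto simp: coeff_pderiv simp del: of_nat_Suc)
  then show "coeff (pderiv Q) k \<in> of_real ` K" by blast
qed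

lemma subst_poly_in: "over_K Q \<Longrightarrow> t \<in> R \<Longrightarrow> subst_poly Q t \<in> R"
  unfolding subst_poly_def by (intro sum_in mult_in Const_in power_in over_K_coeff)

lemma functional_subst_poly:
  assumes "functional L" "over_K Q" "t \<in> R" "p \<in> R"
  shows "L (subst_poly Q t * p) = (\<Sum>k\<le>degree Q. coeff Q k * L (t ^ k * p))"
proof -
  have "subst_poly Q t * p = (\<Sum>k\<le>degree Q. Const (Re (coeff Q k)) * (t ^ k * p))"
    by (simp add: subst_poly_def sum_distrib_right mult.assoc)
  then show ?thesis
    using assms by (simp add: functional_sum functional_scale over_K_coeff)
qed

lemma annihilating_poly:
  assumes "t \<in> R"
  obtains \<mu> where "over_K \<mu>" "\<mu> \<noteq> 0" "subst_poly \<mu> t \<in> I"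
proof -
  obtain N c where c: "\<forall>k\<le>N. c k \<in> K" "\<exists>k\<le>N. c k \<noteq> 0" "(\<Sum>k\<le>N. Const (c k) * t ^ k) \<in> I"
    using algebraic_relation[OF assms] by blast
  define \<mu> :: "complex poly" where "\<mu> = (\<Sum>k\<le>N. monom (of_real (c k)) k)"
  have coeff: "coeff \<mu> k = of_real (if k \<le> N then c k else 0)" for k
    by (simp add: \<mu>_def coeff_sum)
  have "degree \<mu> \<le> N"
    by (rule degree_le) (auto simp: coeff)
  then have "subst_poly \<mu> t = (\<Sum>k\<le>N. Const (Re (coeff \<mu> k)) * t ^ k)"
    unfolding subst_poly_def by (intro sum.mono_neutral_left) (auto simp: coeff_eq_0)
  also have "\<dots> = (\<Sum>k\<le>N. Const (c k) * t ^ k)"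
    by (intro sum.cong) (auto simp: coeff)
  finally have "subst_poly \<mu> t \<in> I" using c by simp
  moreover have "over_K \<mu>"
    using c(1) by (auto simp: over_K_def coeff)
  moreover have "\<mu> \<noteq> 0"
    using c(2) coeff by (metis coeff_0 of_real_eq_0_iff)
  ultimately show thesis using that by blast
qed

text \<open>
  Descent on the degree: a nonconstant polynomial vanishing at \<^term>\<open>\<rho>\<close> would pass the zero on to its
  derivatives, the last of which is a nonzero constant.
\<close>

lemma poly_nonzero_at_if_derivatives:
  assumes "\<And>Q. over_K Q \<Longrightarrow> poly Q \<rho> = 0 \<Longrightarrow> poly (pderiv Q) \<rho> = 0"
  shows "over_K Q \<Longrightarrow> Q \<noteq> 0 \<Longrightarrow> poly Q \<rho> \<noteq> 0"
proof (induction "degree Q" arbitrary: Q)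
  case 0
  then show ?case by (auto elim: degree_eq_zeroE)
next
  case (Suc n)
  have "degree (pderiv Q) = n" using Suc.hyps(2) by (simp add: degree_pderiv)
  moreover have "pderiv Q \<noteq> 0" using Suc.hyps(2) by (auto simp: pderiv_eq_0_iff)
  ultimately show ?case
    using Suc.hyps(1)[of "pderiv Q"] Suc.prems over_K_pderiv assms by metis
qed

text \<open>
  Let \<open>T\<close> be the operator \<open>L \<mapsto> L(t \<cdot>)\<close>; the hypothesis on \<^term>\<open>L\<close> says \<open>(T - \<rho>)\<^sup>2 L = 0\<close> and the claim is
  \<open>(T - \<rho>) L = 0\<close>. Suppose \<open>L' = (T - \<rho>) L\<close> is nonzero. Then \<open>Q(T) L = Q(\<rho>) L + Q'(\<rho>) L'\<close> and
  \<open>Q(T) L' = Q(\<rho>) L'\<close>. If \<open>Q(\<rho>) = 0\<close>, then \<open>y = Q(t)\<close> satisfies \<open>y\<^sup>2 L = 0\<close>, and \<open>y = y\<^sup>2 w\<close> forces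
  \<open>0 = y L = Q'(\<rho>) L'\<close>, so \<open>Q'(\<rho>) = 0\<close>. But \<open>\<rho>\<close> is a root of an annihilating polynomial of \<open>t\<close>.
\<close>

lemma multiplication_semisimple:
  assumes L: "functional L" and t: "t \<in> R"
    and gen: "\<And>p. p \<in> R \<Longrightarrow> L (t * (t * p)) - \<rho> * L (t * p) = \<rho> * (L (t * p) - \<rho> * L p)"
    and p0: "p0 \<in> R"
  shows "L (t * p0) = \<rho> * L p0"
proof (rule ccontr)
  define L' where "L' p = L (t * p) - \<rho> * L p" for p
  assume "L (t * p0) \<noteq> \<rho> * L p0"
  then have nz: "L' p0 \<noteq> 0" by (simp add: L'_def)
  have L': "functional L'"
    using functional_linear[OF functional_shift[OF L t] L, of 1 "- \<rho>"] by (simp add: L'_def[abs_def])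
  have step: "L' (t * p) = \<rho> * L' p" if "p \<in> R" for p
    using gen[OF that] by (simp add: L'_def)
  have L'_pow: "L' (t ^ k * p) = \<rho> ^ k * L' p" if "p \<in> R" for k p
    using that by (induction k) (auto simp: mult.assoc step t)
  have L_pow: "L (t ^ k * p) = \<rho> ^ k * L p + of_nat k * \<rho> ^ (k - 1) * L' p" if "p \<in> R" for k p
  proof (induction k)
    case (Suc k)
    have "L (t ^ Suc k * p) = L' (t ^ k * p) + \<rho> * L (t ^ k * p)"
      by (simp add: L'_def mult.assoc)
    also have "\<dots> = \<rho> ^ k * L' p + \<rho> * (\<rho> ^ k * L p + of_nat k * \<rho> ^ (k - 1) * L' p)"
      using L'_pow Suc that by simp
    also have "\<dots> = \<rho> ^ Suc k * L p + of_nat (Suc k) * \<rho> ^ (Suc k - 1) * L' p"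
      by (cases k) (simp_all add: algebra_simps)
    finally show ?case .
  qed simp
  have L'_subst: "L' (subst_poly Q t * p) = poly Q \<rho> * L' p" if "over_K Q" "p \<in> R" for Q p
    using that t by (simp add: functional_subst_poly[OF L'] L'_pow poly_altdef sum_distrib_right mult.assoc)
  have pderiv_sum: "pderiv (sum u A) = (\<Sum>a\<in>A. pderiv (u a))" for u :: "nat \<Rightarrow> complex poly" and A
    by (induction A rule: infinite_finite_induct) (auto simp: pderiv_add)
  have pderiv: "poly (pderiv Q) \<rho> = (\<Sum>k\<le>degree Q. coeff Q k * (of_nat k * \<rho> ^ (k - 1)))" for Q
  proof -
    have "poly (pderiv Q) \<rho> = poly (pderiv (\<Sum>k\<le>degree Q. monom (coeff Q k) k)) \<rho>"
      by (simp add: poly_as_sum_of_monoms)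
    also have "\<dots> = (\<Sum>k\<le>degree Q. coeff Q k * (of_nat k * \<rho> ^ (k - 1)))"
      by (simp add: pderiv_sum pderiv_monom poly_sum poly_monom mult_ac)
    finally show ?thesis .
  qed
  have L_subst: "L (subst_poly Q t * p) = poly Q \<rho> * L p + poly (pderiv Q) \<rho> * L' p"
    if "over_K Q" "p \<in> R" for Q p
    using that t
    by (simp add: functional_subst_poly[OF L] L_pow poly_altdef[of Q] pderiv sum_distrib_right
        mult.assoc distrib_left sum.distrib)
  have "poly (pderiv Q) \<rho> = 0" if Q: "over_K Q" "poly Q \<rho> = 0" for Q
  proof -
    define y where "y = subst_poly Q t"
    have y: "y \<in> R" using Q t by (simp add: y_def subst_poly_in)
    obtain w where w: "w \<in> R" "y - y\<^sup>2 * w \<in> I" using von_neumann_regular[OF y] by blast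
    have "p0 * (y - y\<^sup>2 * w) \<in> I" using w p0 by (intro ideal_mult) auto
    then have "y * p0 - y * (y * (w * p0)) \<in> I" by (simp add: algebra_simps power2_eq_square)
    then have "L (y * p0) = L (y * (y * (w * p0)))"
      using y w p0 by (intro functional_cong_ideal[OF L]) auto
    also have "\<dots> = poly (pderiv Q) \<rho> * L' (y * (w * p0))"
      using L_subst[of Q "y * (w * p0)"] Q y w p0 by (simp add: y_def)
    also have "L' (y * (w * p0)) = 0"
      using L'_subst[of Q "w * p0"] Q w p0 by (simp add: y_def)
    finally show ?thesis
      using L_subst[of Q p0] Q p0 nz by (simp add: y_def)
  qed
  moreover obtain \<mu> where \<mu>: "over_K \<mu>" "\<mu> \<noteq> 0" "subst_poly \<mu> t \<in> I"
    using annihilating_poly[OF t] by blast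
  moreover have "poly \<mu> \<rho> = 0"
    using L'_subst[of \<mu> p0] \<mu> p0 nz functional_ideal[OF L', of "subst_poly \<mu> t * p0"] ideal_mult[of p0]
    by (simp add: mult.commute)
  ultimately show False using poly_nonzero_at_if_derivatives by blast
qed

text \<open>
  The operator \<open>P(T)\<close> applied to \<^term>\<open>L\<close>, where \<open>T\<close> is \<open>L \<mapsto> L(t \<cdot>)\<close>.
\<close>

definition apply_poly :: "complex poly \<Rightarrow> 'n mpoly \<Rightarrow> ('n mpoly \<Rightarrow> complex) \<Rightarrow> 'n mpoly \<Rightarrow> complex" where
  "apply_poly P t L p = (\<Sum>k\<le>degree P. coeff P k * L (t ^ k * p))"

lemma apply_poly_linear_factor:
  "apply_poly ([:-\<rho>, 1:] * P) t L p = apply_poly P t (\<lambda>p. L (t * p) - \<rho> * L p) p"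
proof (cases "P = 0")
  case False
  have pad: "apply_poly P t L p = (\<Sum>k\<le>N. coeff P k * L (t ^ k * p))" if "degree P \<le> N" for N P
    unfolding apply_poly_def using that by (intro sum.mono_neutral_left) (auto simp: coeff_eq_0)
  have prod: "[:-\<rho>, 1:] * P = pCons 0 P - smult \<rho> P" by simp
  let ?N = "degree P"
  have "apply_poly ([:-\<rho>, 1:] * P) t L p =
      (\<Sum>k\<le>Suc ?N. coeff ([:-\<rho>, 1:] * P) k * L (t ^ k * p))"
    using False by (intro pad) (subst degree_mult_eq, auto)
  also have "\<dots> = (\<Sum>k\<le>Suc ?N. coeff (pCons 0 P) k * L (t ^ k * p)) -
      (\<Sum>k\<le>Suc ?N. \<rho> * coeff P k * L (t ^ k * p))"
    unfolding prod by (simp add: left_diff_distrib sum_subtractf del: sum.atMost_Suc)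
  also have "(\<Sum>k\<le>Suc ?N. coeff (pCons 0 P) k * L (t ^ k * p)) =
      (\<Sum>k\<le>?N. coeff P k * L (t ^ k * (t * p)))"
    by (subst sum.atMost_Suc_shift) (simp add: mult_ac)
  also have "(\<Sum>k\<le>Suc ?N. \<rho> * coeff P k * L (t ^ k * p)) = (\<Sum>k\<le>?N. \<rho> * coeff P k * L (t ^ k * p))"
    by (simp add: coeff_eq_0)
  finally show ?thesis
    by (simp add: apply_poly_def sum_subtractf right_diff_distrib mult_ac)
qed (simp add: apply_poly_def)

text \<open>
  An operator \<open>T\<close> that is killed by a nonzero polynomial and has no Jordan blocks of size 2 is
  diagonalizable. Induction on the degree: for a root \<^term>\<open>\<rho>\<close> of \<^term>\<open>P\<close> the vector \<open>(T - \<rho>) L\<close> is a sum of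
  eigenvectors. Those with an eigenvalue other than \<^term>\<open>\<rho>\<close> are in the image of \<open>T - \<rho>\<close> on eigenvectors;
  subtracting preimages from \<^term>\<open>L\<close> leaves a vector that is killed by \<open>(T - \<rho>)\<^sup>2\<close>, hence by \<open>T - \<rho>\<close>.
  The predicate \<^term>\<open>M\<close> stands for an invariant subspace, which allows the decomposition to be
  repeated inside the eigenspaces of commuting operators.
\<close>

lemma eigenvector_decomposition:
  fixes M :: "('n mpoly \<Rightarrow> complex) \<Rightarrow> bool"
  assumes t: "t \<in> R" and M: "\<And>L. M L \<Longrightarrow> functional L"
    and lin: "\<And>L L' a c. M L \<Longrightarrow> M L' \<Longrightarrow> M (\<lambda>p. a * L p + c * L' p)"
    and shift: "\<And>L. M L \<Longrightarrow> M (\<lambda>p. L (t * p))"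
    and P: "P \<noteq> 0" and L: "M L" and zero: "\<And>p. p \<in> R \<Longrightarrow> apply_poly P t L p = 0"
  shows "\<exists>Es. (\<forall>E\<in>set Es. M E \<and> (\<exists>\<sigma>. \<forall>p\<in>R. E (t * p) = \<sigma> * E p)) \<and> (\<forall>p\<in>R. L p = (\<Sum>E\<leftarrow>Es. E p))"
  using P L zero
proof (induction "degree P" arbitrary: P L)
  case 0
  then obtain c where "P = [:c:]" "c \<noteq> 0" by (auto elim: degree_eq_zeroE)
  then have "\<forall>p\<in>R. L p = 0" using 0 by (auto simp: apply_poly_def)
  then show ?case by (intro exI[of _ "[]"]) auto
next
  case (Suc n)
  have "\<not> constant (poly P)" using Suc.hyps(2) by (simp add: constant_degree)
  then obtain \<rho> where "poly P \<rho> = 0" using fundamental_theorem_of_algebra by blast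
  then obtain P1 where P1: "P = [:-\<rho>, 1:] * P1" by (auto simp: poly_eq_0_iff_dvd)
  have P1': "P1 \<noteq> 0" "degree P1 = n"
    using Suc.prems(1) Suc.hyps(2) degree_mult_eq[of "[:-\<rho>, 1:]" P1] unfolding P1
    by (auto simp del: mult_pCons_left)
  define L1 where "L1 p = L (t * p) - \<rho> * L p" for p
  have ML1: "M L1"
    using lin[OF shift[OF Suc.prems(2)] Suc.prems(2), of 1 "- \<rho>"] by (simp add: L1_def[abs_def])
  have "apply_poly P1 t L1 p = 0" if "p \<in> R" for p
    using Suc.prems(3)[OF that] unfolding P1 apply_poly_linear_factor by (simp add: L1_def[abs_def])
  then obtain Es where Es: "\<forall>E\<in>set Es. M E \<and> (\<exists>\<sigma>. \<forall>p\<in>R. E (t * p) = \<sigma> * E p)"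
      "\<forall>p\<in>R. L1 p = (\<Sum>E\<leftarrow>Es. E p)"
    using Suc.hyps(1)[of P1 L1] P1' ML1 by blast
  have M0: "M (\<lambda>p. 0)" using lin[OF L L, of 0 0] by simp
  \<comment> \<open>Every sum of eigenvectors is \<open>(T - \<rho>)\<close> of a sum of eigenvectors, up to an eigenvector \<open>e\<close> with eigenvalue \<open>\<rho>\<close>.\<close>
  have "\<exists>Ys e. (\<forall>Y\<in>set Ys. M Y \<and> (\<exists>\<sigma>. \<forall>p\<in>R. Y (t * p) = \<sigma> * Y p)) \<and>
      M e \<and> (\<forall>p\<in>R. e (t * p) = \<rho> * e p) \<and>
      (\<forall>p\<in>R. (\<Sum>E\<leftarrow>Es. E p) = (\<Sum>Y\<leftarrow>Ys. Y (t * p)) - \<rho> * (\<Sum>Y\<leftarrow>Ys. Y p) + e p)"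
    using Es(1)
  proof (induction Es)
    case Nil
    then show ?case using M0 by (intro exI[of _ "[]"] exI[of _ "\<lambda>p. 0"]) auto
  next
    case (Cons E Es)
    then obtain Ys e where Ys: "\<forall>Y\<in>set Ys. M Y \<and> (\<exists>\<sigma>. \<forall>p\<in>R. Y (t * p) = \<sigma> * Y p)"
        "M e" "\<forall>p\<in>R. e (t * p) = \<rho> * e p"
        "\<forall>p\<in>R. (\<Sum>E\<leftarrow>Es. E p) = (\<Sum>Y\<leftarrow>Ys. Y (t * p)) - \<rho> * (\<Sum>Y\<leftarrow>Ys. Y p) + e p"
      by auto
    obtain \<sigma> where E: "M E" "\<forall>p\<in>R. E (t * p) = \<sigma> * E p" using Cons.prems by auto
    show ?case
    proof (cases "\<sigma> = \<rho>")
      case True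
      have "M (\<lambda>p. E p + e p)" using lin[OF E(1) Ys(2), of 1 1] by simp
      then show ?thesis
        using Ys E True by (intro exI[of _ Ys] exI[of _ "\<lambda>p. E p + e p"]) (auto simp: algebra_simps)
    next
      case False
      define Y where "Y p = E p / (\<sigma> - \<rho>)" for p
      have "M Y" using lin[OF E(1) E(1), of "1 / (\<sigma> - \<rho>)" 0] by (simp add: Y_def[abs_def])
      moreover have "\<forall>p\<in>R. Y (t * p) = \<sigma> * Y p" using E(2) by (simp add: Y_def)
      moreover have "E p = Y (t * p) - \<rho> * Y p" if "p \<in> R" for p
      proof -
        have "Y (t * p) - \<rho> * Y p = (\<sigma> - \<rho>) * Y p"
          using E(2) that by (simp add: Y_def left_diff_distrib diff_divide_distrib)
        then show ?thesis using False by (simp add: Y_def)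
      qed
      ultimately show ?thesis
        using Ys by (intro exI[of _ "Y # Ys"] exI[of _ e]) (auto simp: algebra_simps)
    qed
  qed
  then obtain Ys e where Ys: "\<forall>Y\<in>set Ys. M Y \<and> (\<exists>\<sigma>. \<forall>p\<in>R. Y (t * p) = \<sigma> * Y p)"
      "M e" "\<forall>p\<in>R. e (t * p) = \<rho> * e p"
      "\<forall>p\<in>R. L1 p = (\<Sum>Y\<leftarrow>Ys. Y (t * p)) - \<rho> * (\<Sum>Y\<leftarrow>Ys. Y p) + e p"
    using Es(2) by auto
  define N where "N p = L p - (\<Sum>Y\<leftarrow>Ys. Y p)" for p
  have "M (\<lambda>p. \<Sum>Y\<leftarrow>Ys. Y p)"
    using Ys(1)
  proof (induction Ys)
    case (Cons Y Ys)
    then show ?case using lin[of Y "\<lambda>p. \<Sum>Y\<leftarrow>Ys. Y p" 1 1] by simp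
  qed (simp add: M0)
  then have MN: "M N"
    using lin[OF Suc.prems(2), of _ 1 "-1"] by (simp add: N_def[abs_def])
  have N1: "N (t * p) - \<rho> * N p = e p" if "p \<in> R" for p
    using Ys(4) that by (simp add: N_def L1_def algebra_simps)
  have "N (t * p) = \<rho> * N p" if "p \<in> R" for p
  proof (rule multiplication_semisimple[OF M[OF MN] t _ that])
    fix p :: "'n mpoly" assume p: "p \<in> R"
    then show "N (t * (t * p)) - \<rho> * N (t * p) = \<rho> * (N (t * p) - \<rho> * N p)"
      using N1[of p] N1[of "t * p"] Ys(3) t by auto
  qed
  then show ?case
    using Ys(1) MN by (intro exI[of _ "N # Ys"]) (auto simp: N_def)
qed

text \<open>
  The eigenvalue equations compute \<^term>\<open>L\<close> on monomials.
\<close>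

lemma joint_eigenvector:
  assumes L: "functional L" and eig: "\<And>i p. p \<in> R \<Longrightarrow> L (variable i * p) = z $ i * L p" and p: "p \<in> R"
  shows "L p = L 1 * poly_eval p z"
proof -
  have pow: "L (variable i ^ k * q) = (z $ i) ^ k * L q" if "q \<in> R" for i k q
    using that by (induction k) (auto simp: mult.assoc eig)
  have mon: "L ((\<Prod>i\<in>A. variable i ^ lookup m i) * 1) = (\<Prod>i\<in>A. (z $ i) ^ lookup m i) * L 1" for A m
  proof (induction A rule: infinite_finite_induct)
    case (insert i A)
    then show ?case
      using pow[of "\<Prod>i\<in>A. variable i ^ lookup m i" i "lookup m i"] prod_in[of A "\<lambda>i. variable i ^ lookup m i"]
      by (simp add: mult.assoc)
  qed auto
  have "L (single m c) = of_real c * (mon_eval m z * L 1)" if "c \<in> K" for m c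
  proof -
    have "single m c = Const c * single m 1" by (simp add: Const_def mult_single)
    then show ?thesis
      using functional_scale[OF L that, of "single m 1"] mon[of m UNIV]
      by (simp add: monomial_eq_prod_variables[symmetric] mon_eval_def)
  qed
  moreover have "L p = L (\<Sum>m\<in>keys p. single m (lookup p m))"
    by (rule arg_cong[OF sum_of_terms])
  moreover have "\<dots> = (\<Sum>m\<in>keys p. L (single m (lookup p m)))"
    using p by (intro functional_sum[OF L] single_in) (simp add: poly_ring_def)
  ultimately show ?thesis
    using p by (simp add: poly_eval_superset[of "keys p"] poly_ring_def sum_distrib_left mult_ac)
qed

text \<open>
  Diagonalize multiplication by the variables one after the other. The induction is on the set \<^term>\<open>J\<close> of
  variables for which \<^term>\<open>L\<close> need not yet be an eigenvector. When \<^term>\<open>J\<close> is empty, \<^term>\<open>L\<close> is a multiple of the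
  evaluation at the point \<^term>\<open>z\<close> of eigenvalues, and \<^term>\<open>z\<close> is a zero of \<^term>\<open>I\<close> unless \<^term>\<open>L\<close> is zero.
\<close>

theorem functional_combination_of_evaluations:
  assumes "functional L"
  shows "\<exists>a. \<forall>p\<in>R. L p = (\<Sum>\<xi>\<in>zeros. a \<xi> * poly_eval p \<xi>)"
proof -
  have zeros: "finite zeros" using finite_zeros by (simp add: zeros_def)
  have "\<exists>a. \<forall>p\<in>R. L p = (\<Sum>\<xi>\<in>zeros. a \<xi> * poly_eval p \<xi>)"
    if "finite J" "functional L" "\<And>i p. i \<notin> J \<Longrightarrow> p \<in> R \<Longrightarrow> L (variable i * p) = z $ i * L p" for J L z
    using that
  proof (induction J arbitrary: L z rule: finite_induct)
    case empty
    then have L: "L p = L 1 * poly_eval p z" if "p \<in> R" for p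
      using joint_eigenvector that by blast
    show ?case
    proof (cases "L 1 = 0")
      case True
      then have "L p = 0" if "p \<in> R" for p using L[OF that] by simp
      then show ?thesis by (intro exI[of _ "\<lambda>_. 0"]) auto
    next
      case False
      have "poly_eval p z = 0" if "p \<in> I" for p
      proof -
        have "L 1 * poly_eval p z = L p" using L[of p] that ideal_subset by auto
        then show ?thesis using functional_ideal[OF empty.prems(1) that] False by simp
      qed
      then have "z \<in> zeros" by (simp add: zeros_def)
      have "\<forall>p\<in>R. L p = (\<Sum>\<xi>\<in>zeros. (if \<xi> = z then L 1 else 0) * poly_eval p \<xi>)"
        using zeros \<open>z \<in> zeros\<close> by (auto intro!: trans[OF L] simp: if_distrib[of "\<lambda>c. c * _"] cong: if_cong)
      then show ?thesis by (intro exI[of _ "\<lambda>\<xi>. if \<xi> = z then L 1 else 0"])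
    qed
  next
    case (insert j J)
    define M where "M E \<longleftrightarrow> functional E \<and> (\<forall>i p. i \<notin> insert j J \<longrightarrow> p \<in> R \<longrightarrow> E (variable i * p) = z $ i * E p)" for E
    obtain \<mu> where \<mu>: "over_K \<mu>" "\<mu> \<noteq> 0" "subst_poly \<mu> (variable j) \<in> I"
      using annihilating_poly variable_in by blast
    have "\<exists>Es. (\<forall>E\<in>set Es. M E \<and> (\<exists>\<sigma>. \<forall>p\<in>R. E (variable j * p) = \<sigma> * E p)) \<and> (\<forall>p\<in>R. L p = (\<Sum>E\<leftarrow>Es. E p))"
    proof (rule eigenvector_decomposition[OF variable_in _ _ _ \<mu>(2)])
      show "M (\<lambda>p. E (variable j * p))" if "M E" for E
        using that functional_shift[of E] by (auto simp: M_def mult.left_commute[of "variable j"])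
      show "M (\<lambda>p. a * E p + c * E' p)" if "M E" "M E'" for E E' a c
        using that functional_linear[of E E'] by (auto simp: M_def algebra_simps)
      show "apply_poly \<mu> (variable j) L p = 0" if "p \<in> R" for p
      proof -
        have "p * subst_poly \<mu> (variable j) \<in> I" using that \<mu> by (intro ideal_mult) auto
        then show ?thesis
          using functional_subst_poly[OF insert.prems(1) \<mu>(1) variable_in[of j] that]
            functional_ideal[OF insert.prems(1)] by (simp add: apply_poly_def mult.commute)
      qed
    qed (use insert.prems in \<open>auto simp: M_def\<close>)
    then obtain Es where Es: "\<forall>E\<in>set Es. M E \<and> (\<exists>\<sigma>. \<forall>p\<in>R. E (variable j * p) = \<sigma> * E p)"
        "\<forall>p\<in>R. L p = (\<Sum>E\<leftarrow>Es. E p)" by blast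
    have "\<exists>a. \<forall>p\<in>R. E p = (\<Sum>\<xi>\<in>zeros. a \<xi> * poly_eval p \<xi>)" if E: "E \<in> set Es" for E
    proof -
      obtain \<sigma> where \<sigma>: "\<forall>p\<in>R. E (variable j * p) = \<sigma> * E p" using Es E by blast
      show ?thesis
      proof (rule insert.IH)
        show "functional E" using Es E by (auto simp: M_def)
        show "E (variable i * p) = (\<chi> i. if i = j then \<sigma> else z $ i) $ i * E p" if "i \<notin> J" "p \<in> R" for i p
          using that \<sigma> Es E by (auto simp: M_def)
      qed
    qed
    then have "\<exists>a. \<forall>p\<in>R. (\<Sum>E\<leftarrow>Es. E p) = (\<Sum>\<xi>\<in>zeros. a \<xi> * poly_eval p \<xi>)"
    proof (induction Es)
      case Nil
      then show ?case by (intro exI[of _ "\<lambda>_. 0"]) auto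
    next
      case (Cons E Es)
      obtain a where "\<forall>p\<in>R. E p = (\<Sum>\<xi>\<in>zeros. a \<xi> * poly_eval p \<xi>)"
        using Cons.prems[of E] by auto
      moreover obtain a' where "\<forall>p\<in>R. (\<Sum>E\<leftarrow>Es. E p) = (\<Sum>\<xi>\<in>zeros. a' \<xi> * poly_eval p \<xi>)"
        using Cons.IH[OF Cons.prems[OF list.set_intros(2)]] by blast
      ultimately show ?case
        by (intro exI[of _ "\<lambda>\<xi>. a \<xi> + a' \<xi>"]) (auto simp: distrib_right sum.distrib)
    qed
    with Es(2) show ?case by auto
  qed
  from this[of UNIV L undefined] assms show ?thesis by auto
qed

end

section \<open>Interpolation on the zeros\<close>

context finite_quotient
begin

lemma conj_point_zeros: "z \<in> zeros \<Longrightarrow> conj_point z \<in> zeros"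
  by (simp add: zeros_def poly_eval_conj_point)

lemma finite_zero_set [simp]: "finite zeros"
  using finite_zeros by (simp add: zeros_def)

lemma poly_eval_combination:
  "poly_eval (combination d) x = (\<Sum>b\<in>B. of_real (d b) * poly_eval b x)"
  by (simp add: combination_def poly_eval_ring_hom)

lemma poly_eval_expand:
  assumes "p \<in> R" "\<xi> \<in> zeros"
  shows "poly_eval p \<xi> = poly_eval (combination (coord p)) \<xi>"
  using coord_expand[OF assms(1)] assms(2) by (auto simp: zeros_def poly_eval_diff dest!: bspec)

lemma coord_combination_of_evaluations:
  obtains a where "\<And>b p. b \<in> B \<Longrightarrow> p \<in> R \<Longrightarrow>
    complex_of_real (coord p b) = (\<Sum>\<xi>\<in>zeros. a b \<xi> * poly_eval p \<xi>)"
proof -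
  have "\<forall>b\<in>B. \<exists>a. \<forall>p\<in>R. complex_of_real (coord p b) = (\<Sum>\<xi>\<in>zeros. a \<xi> * poly_eval p \<xi>)"
    using functional_combination_of_evaluations[OF functional_coord] by blast
  from bchoice[OF this] that show thesis by metis
qed

text \<open>
  A Nullstellensatz: the coordinates of \<^term>\<open>p\<close> are combinations of its values on the zeros.
\<close>

lemma vanishing_in_ideal:
  assumes p: "p \<in> R" and "\<And>\<xi>. \<xi> \<in> zeros \<Longrightarrow> poly_eval p \<xi> = 0"
  shows "p \<in> I"
proof -
  obtain a where "\<And>b p. b \<in> B \<Longrightarrow> p \<in> R \<Longrightarrow>
      complex_of_real (coord p b) = (\<Sum>\<xi>\<in>zeros. a b \<xi> * poly_eval p \<xi>)"
    using coord_combination_of_evaluations by blast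
  from this[OF _ p] have "coord p b = 0" if "b \<in> B" for b
    using assms(2) that by (metis (no_types, lifting) mult_zero_right of_real_eq_0_iff sum.neutral)
  then have "combination (coord p) = 0" by (simp add: combination_def)
  then show ?thesis using coord_expand[OF p] by simp
qed

text \<open>
  Independence over \<^term>\<open>K\<close> extends to \<open>\<complex>\<close> because the coordinate functionals, being combinations of
  evaluations, make sense for arbitrary functions on the zeros.
\<close>

lemma basis_independent_on_zeros:
  assumes zero: "\<And>\<xi>. \<xi> \<in> zeros \<Longrightarrow> (\<Sum>b\<in>B. d b * poly_eval b \<xi>) = 0" and b: "b \<in> B"
  shows "d b = 0"
proof -
  obtain a where a: "\<And>b p. b \<in> B \<Longrightarrow> p \<in> R \<Longrightarrow>
      complex_of_real (coord p b) = (\<Sum>\<xi>\<in>zeros. a b \<xi> * poly_eval p \<xi>)"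
    using coord_combination_of_evaluations by blast
  have "0 = (\<Sum>\<xi>\<in>zeros. a b \<xi> * (\<Sum>b'\<in>B. d b' * poly_eval b' \<xi>))"
    using zero by simp
  also have "\<dots> = (\<Sum>b'\<in>B. d b' * (\<Sum>\<xi>\<in>zeros. a b \<xi> * poly_eval b' \<xi>))"
    unfolding sum_distrib_left by (subst sum.swap) (simp add: mult_ac)
  also have "\<dots> = (\<Sum>b'\<in>B. d b' * of_real (coord b' b))"
    using a[OF b] basis_subset by (intro sum.cong refl) (metis subsetD)
  also have "\<dots> = (\<Sum>b'\<in>B. if b' = b then d b else 0)"
    using b by (intro sum.cong refl) (auto simp: coord_basis)
  finally show ?thesis using b finite_basis by simp
qed

text \<open>
  The functions on the zeros that are complex combinations of \<^term>\<open>B\<close> form an algebra, since products of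
  basis elements can be rewritten in terms of \<^term>\<open>B\<close> modulo \<^term>\<open>I\<close>. The algebra contains the coordinate functions,
  hence the Lagrange interpolation polynomials.
\<close>

lemma complex_interpolation: "\<exists>d. \<forall>\<eta>\<in>zeros. \<phi> \<eta> = (\<Sum>b\<in>B. d b * poly_eval b \<eta>)"
proof -
  define S where "S \<phi> \<longleftrightarrow> (\<exists>d. \<forall>\<eta>\<in>zeros. \<phi> \<eta> = (\<Sum>b\<in>B. d b * poly_eval b \<eta>))"
    for \<phi> :: "complex ^ 'n \<Rightarrow> complex"
  have S_poly: "S (poly_eval p)" if "p \<in> R" for p
    unfolding S_def using poly_eval_expand[OF that]
    by (intro exI[of _ "\<lambda>b. of_real (coord p b)"]) (simp add: poly_eval_combination)
  have S_scale: "S (\<lambda>\<eta>. c * \<phi> \<eta>)" if *: "S \<phi>" for c \<phi>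
  proof -
    obtain d where "\<forall>\<eta>\<in>zeros. \<phi> \<eta> = (\<Sum>b\<in>B. d b * poly_eval b \<eta>)" using * by (auto simp: S_def)
    then show ?thesis unfolding S_def
      by (intro exI[of _ "\<lambda>b. c * d b"]) (simp add: sum_distrib_left mult.assoc)
  qed
  have S_add: "S (\<lambda>\<eta>. \<phi> \<eta> + \<psi> \<eta>)" if *: "S \<phi>" "S \<psi>" for \<phi> \<psi>
  proof -
    obtain d d' where "\<forall>\<eta>\<in>zeros. \<phi> \<eta> = (\<Sum>b\<in>B. d b * poly_eval b \<eta>)"
      "\<forall>\<eta>\<in>zeros. \<psi> \<eta> = (\<Sum>b\<in>B. d' b * poly_eval b \<eta>)" using * by (auto simp: S_def)
    then show ?thesis unfolding S_def
      by (intro exI[of _ "\<lambda>b. d b + d' b"]) (simp add: sum.distrib distrib_right)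
  qed
  have S_sum: "S (\<lambda>\<eta>. \<Sum>a\<in>A. u a \<eta>)" if "\<And>a. a \<in> A \<Longrightarrow> S (u a)" for A :: "'c set" and u
    using that
  proof (induction A rule: infinite_finite_induct)
    case (insert a A)
    then show ?case using S_add[of "u a" "\<lambda>\<eta>. \<Sum>a\<in>A. u a \<eta>"] by simp
  qed (auto simp: S_def intro!: exI[of _ "\<lambda>b. 0"])
  have S_cong: "S \<psi>" if "S \<phi>" "\<And>\<eta>. \<eta> \<in> zeros \<Longrightarrow> \<psi> \<eta> = \<phi> \<eta>" for \<phi> \<psi>
    using that by (auto simp: S_def)
  have S_mult: "S (\<lambda>\<eta>. \<phi> \<eta> * \<psi> \<eta>)" if *: "S \<phi>" "S \<psi>" for \<phi> \<psi>
  proof -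
    obtain d d' where d: "\<forall>\<eta>\<in>zeros. \<phi> \<eta> = (\<Sum>b\<in>B. d b * poly_eval b \<eta>)"
      "\<forall>\<eta>\<in>zeros. \<psi> \<eta> = (\<Sum>b\<in>B. d' b * poly_eval b \<eta>)" using * by (auto simp: S_def)
    show ?thesis
    proof (rule S_cong)
      show "S (\<lambda>\<eta>. \<Sum>b\<in>B. \<Sum>b'\<in>B. (d b * d' b') * poly_eval (b * b') \<eta>)"
        using basis_subset by (intro S_sum S_scale S_poly) auto
    qed (use d in \<open>simp add: sum_product poly_eval_mult mult.assoc mult.left_commute\<close>)
  qed
  have S_const: "S (\<lambda>\<eta>. c)" for c
    using S_scale[OF S_poly[of 1], of c] by simp
  have S_prod: "S (\<lambda>\<eta>. \<Prod>a\<in>A. u a \<eta>)" if "\<And>a. a \<in> A \<Longrightarrow> S (u a)" for A :: "(complex ^ 'n) set" and u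
    using that
  proof (induction A rule: infinite_finite_induct)
    case (insert a A)
    then show ?case using S_mult[of "u a" "\<lambda>\<eta>. \<Prod>a\<in>A. u a \<eta>"] by simp
  qed (use S_const in auto)
  have delta: "S (\<lambda>\<eta>. if \<eta> = \<xi> then 1 else 0)" if "\<xi> \<in> zeros" for \<xi>
  proof -
    define j where "j \<zeta> = (SOME i. \<xi> $ i \<noteq> \<zeta> $ i)" for \<zeta>
    have j: "\<xi> $ j \<zeta> \<noteq> \<zeta> $ j \<zeta>" if "\<zeta> \<noteq> \<xi>" for \<zeta>
      unfolding j_def by (rule someI_ex) (use that in \<open>metis vec_eq_iff\<close>)
    have factor: "S (\<lambda>\<eta>. (\<eta> $ i - c) / e)" for i c e
      using S_scale[OF S_add[OF S_poly[OF variable_in[of i]] S_const[of "- c"]], of "1 / e"] by simp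
    show ?thesis
    proof (rule S_cong[OF S_prod])
      show "S (\<lambda>\<eta>. (\<eta> $ j \<zeta> - \<zeta> $ j \<zeta>) / (\<xi> $ j \<zeta> - \<zeta> $ j \<zeta>))" for \<zeta> by (rule factor)
      fix \<eta> assume \<eta>: "\<eta> \<in> zeros"
      show "(if \<eta> = \<xi> then 1 else 0) =
          (\<Prod>\<zeta>\<in>zeros - {\<xi>}. (\<eta> $ j \<zeta> - \<zeta> $ j \<zeta>) / (\<xi> $ j \<zeta> - \<zeta> $ j \<zeta>))"
      proof (cases "\<eta> = \<xi>")
        case True
        then show ?thesis using j by (auto intro!: prod.neutral[symmetric])
      next
        case False
        then show ?thesis using \<eta> by (auto intro!: prod_zero[symmetric])
      qed
    qed
  qed
  have "S (\<lambda>\<eta>. \<Sum>\<xi>\<in>zeros. \<phi> \<xi> * (if \<eta> = \<xi> then 1 else 0))"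
    by (intro S_sum S_scale delta)
  then have "S \<phi>"
    by (rule S_cong) (simp add: if_distrib[of "\<lambda>c. _ * c"] cong: if_cong)
  then show ?thesis by (simp add: S_def)
qed

text \<open>
  For data compatible with complex conjugation, the conjugates of the interpolating coefficients
  interpolate too, so their real parts do.
\<close>

lemma real_interpolation:
  assumes sym: "\<And>\<xi>. \<xi> \<in> zeros \<Longrightarrow> \<phi> (conj_point \<xi>) = cnj (\<phi> \<xi>)"
  shows "\<exists>d :: _ \<Rightarrow> real. \<forall>\<xi>\<in>zeros. poly_eval (combination d) \<xi> = \<phi> \<xi>"
proof -
  obtain e where e: "\<And>\<xi>. \<xi> \<in> zeros \<Longrightarrow> \<phi> \<xi> = (\<Sum>b\<in>B. e b * poly_eval b \<xi>)"
    using complex_interpolation by blast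
  have "poly_eval (combination (\<lambda>b. Re (e b))) \<xi> = \<phi> \<xi>" if \<xi>: "\<xi> \<in> zeros" for \<xi>
  proof -
    have "cnj (\<phi> (conj_point \<xi>)) = (\<Sum>b\<in>B. cnj (e b) * poly_eval b \<xi>)"
      using e[OF conj_point_zeros[OF \<xi>]] by (simp add: poly_eval_conj_point)
    then have "2 * \<phi> \<xi> = (\<Sum>b\<in>B. e b * poly_eval b \<xi>) + (\<Sum>b\<in>B. cnj (e b) * poly_eval b \<xi>)"
      using sym[OF \<xi>] e[OF \<xi>] by simp
    also have "\<dots> = 2 * poly_eval (combination (\<lambda>b. Re (e b))) \<xi>"
      by (simp add: poly_eval_combination sum.distrib[symmetric] distrib_right[symmetric]
          complex_add_cnj sum_distrib_left mult.assoc)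
    finally show ?thesis by simp
  qed
  then show ?thesis by blast
qed

definition real_zeros :: "(real ^ 'n) set" where
  "real_zeros = {x. complexify x \<in> zeros}"

lemma finite_real_zeros [simp]: "finite real_zeros"
  using finite_vimageI[OF finite_zero_set inj_complexify] by (simp add: real_zeros_def vimage_def)

lemma real_zeros_eval: "p \<in> I \<Longrightarrow> x \<in> real_zeros \<Longrightarrow> poly_eval p x = 0"
  by (auto simp: real_zeros_def zeros_def poly_eval_complexify)

text \<open>
  Interpolate the prescribed values with real coefficients, using the value 0 at nonreal zeros, and
  approximate the coefficients by elements of \<^term>\<open>K\<close>.
\<close>

lemma approximate_values:
  fixes v :: "real ^ 'n \<Rightarrow> real"
  obtains u where "\<And>n :: nat. \<And>b. u n b \<in> K"
    "\<And>x. x \<in> real_zeros \<Longrightarrow> (\<lambda>n. poly_eval (combination (u n)) x) \<longlonglongrightarrow> v x"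
proof -
  define \<phi> where "\<phi> z = (if z \<in> range complexify then complex_of_real (v (inv complexify z)) else 0)" for z
  have \<phi>: "\<phi> (complexify x) = of_real (v x)" for x
    by (simp add: \<phi>_def inv_f_f[OF inj_complexify])
  have "\<phi> (conj_point \<xi>) = cnj (\<phi> \<xi>)" for \<xi>
    using conj_point_fixed_iff[of \<xi>] conj_point_fixed_iff[of "conj_point \<xi>"] by (auto simp: \<phi>_def)
  then obtain d :: "'n mpoly \<Rightarrow> real" where d: "\<forall>\<xi>\<in>zeros. poly_eval (combination d) \<xi> = \<phi> \<xi>"
    using real_interpolation[of \<phi>] by blast
  have "\<forall>b. \<exists>u. (\<forall>n :: nat. u n \<in> K) \<and> u \<longlonglongrightarrow> d b"
    using approximating_sequence by metis
  then obtain u where u: "\<And>b n. u b n \<in> K" "\<And>b. u b \<longlonglongrightarrow> d b" by metis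
  show thesis
  proof (rule that[of "\<lambda>n b. u b n"])
    fix x assume x: "x \<in> real_zeros"
    have "(\<lambda>n. poly_eval (combination (\<lambda>b. u b n)) x) \<longlonglongrightarrow> poly_eval (combination d) x"
      unfolding poly_eval_combination using u(2) by (auto intro!: tendsto_intros)
    moreover have "poly_eval (combination d) x = v x"
      using d x \<phi>[of x] by (auto simp: real_zeros_def poly_eval_complexify)
    ultimately show "(\<lambda>n. poly_eval (combination (\<lambda>b. u b n)) x) \<longlonglongrightarrow> v x" by simp
  qed (use u in auto)
qed

end

section \<open>Positive polynomials as weighted sums of squares\<close>

text \<open>
  The principal square root does not commute with conjugation on the negative real axis. At a
  nonreal point the choice is therefore made according to the sign of a nonzero imaginary part, the
  same coordinate being used for the point and its conjugate.
\<close>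

lemma conjugation_invariant_sqrt:
  fixes \<psi> :: "complex ^ 'n \<Rightarrow> complex"
  assumes sym: "\<And>z. z \<in> Z \<Longrightarrow> \<psi> (conj_point z) = cnj (\<psi> z)"
    and nonneg: "\<And>x. complexify x \<in> Z \<Longrightarrow> \<exists>a\<ge>0. \<psi> (complexify x) = of_real a"
  shows "\<exists>\<sigma>. \<forall>z\<in>Z. \<sigma> (conj_point z) = cnj (\<sigma> z) \<and> (\<sigma> z)\<^sup>2 = \<psi> z"
proof -
  define j where "j z = (SOME i. Im (z $ i) \<noteq> 0)" for z :: "complex ^ 'n"
  define \<sigma> where "\<sigma> z = (if Im (z $ j z) < 0 then cnj (csqrt (cnj (\<psi> z))) else csqrt (\<psi> z))" for z
  have j_conj: "j (conj_point z) = j z" for z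
    by (simp add: j_def conj_point_def)
  show ?thesis
  proof (intro exI[of _ \<sigma>] ballI conjI)
    fix z assume z: "z \<in> Z"
    show "(\<sigma> z)\<^sup>2 = \<psi> z" by (simp add: \<sigma>_def flip: complex_cnj_power)
    show "\<sigma> (conj_point z) = cnj (\<sigma> z)"
    proof (cases "\<exists>i. Im (z $ i) \<noteq> 0")
      case True
      then have "Im (z $ j z) \<noteq> 0" unfolding j_def by (rule someI_ex)
      moreover have "Im (conj_point z $ j z) = - Im (z $ j z)" by (simp add: conj_point_def)
      ultimately show ?thesis using sym[OF z] by (auto simp: \<sigma>_def j_conj)
    next
      case False
      then have "conj_point z = z"
        by (simp add: conj_point_def vec_eq_iff complex_eq_iff)
      moreover from this obtain x where "z = complexify x" using conj_point_fixed_iff by blast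
      moreover from this obtain a where "a \<ge> 0" "\<psi> z = of_real a" using nonneg z by blast
      ultimately show ?thesis using False by (simp add: \<sigma>_def flip: of_real_sqrt)
    qed
  qed
qed

text \<open>
  Any nonzero vector \<^term>\<open>\<phi>\<close> is the barycenter of a basis arbitrarily close to it: with \<open>e\<^sub>b\<close> the
  standard basis and \<^term>\<open>\<phi> b0\<close> nonzero, take \<open>\<phi> + \<delta> e\<^sub>b\<close> for \<open>b \<noteq> b0\<close> and, to balance them,
  \<open>\<phi> - \<delta> \<Sum> e\<^sub>b\<close>. The matrix \<^term>\<open>\<tau>\<close> is its dual basis; all dual coordinates of \<^term>\<open>\<phi>\<close> are \<open>1 / card B\<close>.
\<close>

lemma simplicial_cone_around:
  fixes \<phi> :: "'b \<Rightarrow> real"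
  assumes B: "finite B" "b0 \<in> B" and \<phi>: "\<phi> b0 \<noteq> 0" and \<delta>: "\<delta> \<noteq> 0"
  defines "s l b \<equiv> \<phi> b + \<delta> * (if l = b0 then (if b = b0 then 0 else - 1) else (if b = l then 1 else 0))"
  shows "\<exists>\<tau>. (\<forall>k\<in>B. \<forall>l\<in>B. (\<Sum>b\<in>B. \<tau> k b * s l b) = (if k = l then 1 else 0)) \<and>
             (\<forall>k\<in>B. (\<Sum>b\<in>B. \<tau> k b * \<phi> b) > 0)"
proof -
  define C where "C = B - {b0}"
  define N where "N = real (card B)"
  define \<Phi> where "\<Phi> = sum \<phi> C"
  have BC: "B = insert b0 C" "b0 \<notin> C" "finite C" using B by (auto simp: C_def)
  have N: "N > 0" "real (card C) = N - 1"
    using B BC by (auto simp: N_def card_gt_0_iff)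
  define \<tau> where "\<tau> k b = (if b = b0 then (1 + \<Phi> / \<delta>) / (\<phi> b0 * N) else - 1 / (\<delta> * N)) +
      (if k = b0 then 0 else (if b = b0 then - \<phi> k / \<phi> b0 else if b = k then 1 else 0) / \<delta>)" for k b
  have \<tau>: "(\<Sum>b\<in>B. \<tau> k b * v b) = (v b0 / \<phi> b0 * (1 + \<Phi> / \<delta>) - sum v C / \<delta>) / N +
      (if k = b0 then 0 else (v k - v b0 * \<phi> k / \<phi> b0) / \<delta>)" if "k \<in> B" for k v
  proof -
    have "(\<Sum>b\<in>C. \<tau> k b * v b) = (\<Sum>b\<in>C. - 1 / (\<delta> * N) * v b + (if b = k then v k / \<delta> else 0))"
      using BC by (intro sum.cong) (auto simp: \<tau>_def algebra_simps)
    also have "\<dots> = - 1 / (\<delta> * N) * sum v C + (if k = b0 then 0 else v k / \<delta>)"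
      unfolding sum.distrib sum_distrib_left[symmetric] using BC that by auto
    finally have C: "(\<Sum>b\<in>C. \<tau> k b * v b) =
        - 1 / (\<delta> * N) * sum v C + (if k = b0 then 0 else v k / \<delta>)" .
    have "(\<Sum>b\<in>B. \<tau> k b * v b) = \<tau> k b0 * v b0 + (\<Sum>b\<in>C. \<tau> k b * v b)"
      by (subst BC(1), rule sum.insert) (use BC in auto)
    also have "\<dots> = (v b0 / \<phi> b0 * (1 + \<Phi> / \<delta>) - sum v C / \<delta>) / N +
        (if k = b0 then 0 else (v k - v b0 * \<phi> k / \<phi> b0) / \<delta>)"
      unfolding C using N \<phi> \<delta> by (cases "k = b0") (simp_all add: \<tau>_def field_simps)
    finally show ?thesis .
  qed
  have s: "s l b0 = \<phi> b0" "sum (s l) C = \<Phi> + (if l = b0 then - \<delta> * (N - 1) else \<delta>)"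
    "k \<in> C \<Longrightarrow> s l k = \<phi> k + \<delta> * (if l = b0 then - 1 else if k = l then 1 else 0)" if "l \<in> B" for k l
  proof -
    have "sum (s l) C = (\<Sum>b\<in>C. \<phi> b + (if l = b0 then - \<delta> else if b = l then \<delta> else 0))"
      unfolding s_def using BC by (intro sum.cong) auto
    then show "sum (s l) C = \<Phi> + (if l = b0 then - \<delta> * (N - 1) else \<delta>)"
      using BC that N by (auto simp: sum.distrib \<Phi>_def algebra_simps)
  qed (use BC that in \<open>auto simp: s_def\<close>)
  show ?thesis
  proof (intro exI[of _ \<tau>] conjI ballI)
    fix k l assume k: "k \<in> B" and l: "l \<in> B"
    show "(\<Sum>b\<in>B. \<tau> k b * s l b) = (if k = l then 1 else 0)"
    proof (cases "k = b0")
      case True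
      show ?thesis
        unfolding \<tau>[OF k] s(1,2)[OF l] using True N \<phi> \<delta> by (auto simp: field_simps)
    next
      case False
      then have "k \<in> C" using k BC by auto
      then show ?thesis
        unfolding \<tau>[OF k] s(1,2)[OF l] s(3)[OF l \<open>k \<in> C\<close>] using False N \<phi> \<delta>
        by (auto simp: field_simps)
    qed
  next
    fix k assume k: "k \<in> B"
    show "(\<Sum>b\<in>B. \<tau> k b * \<phi> b) > 0"
      unfolding \<tau>[OF k] using N \<phi> \<delta> by (auto simp: \<Phi>_def field_simps)
  qed
qed

context finite_quotient
begin

text \<open>
  The coordinates of the square of \<^term>\<open>combination d\<close>. As a formula in \<^term>\<open>d\<close> it is also meaningful, and continuous,
  for real coefficients outside \<^term>\<open>K\<close>.
\<close>

definition square_coord :: "('n mpoly \<Rightarrow> real) \<Rightarrow> 'n mpoly \<Rightarrow> real" where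
  "square_coord d c = (\<Sum>b\<in>B. \<Sum>b'\<in>B. d b * d b' * coord (b * b') c)"

lemma poly_eval_square:
  assumes "\<xi> \<in> zeros"
  shows "(poly_eval (combination d) \<xi>)\<^sup>2 = poly_eval (combination (square_coord d)) \<xi>"
proof -
  have "(poly_eval (combination d) \<xi>)\<^sup>2 =
      (\<Sum>b\<in>B. \<Sum>b'\<in>B. of_real (d b * d b') * poly_eval (b * b') \<xi>)"
    by (simp add: poly_eval_combination power2_eq_square sum_product poly_eval_mult mult_ac)
  also have "\<dots> = (\<Sum>b\<in>B. \<Sum>b'\<in>B. \<Sum>c\<in>B. of_real (d b * d b') * (of_real (coord (b * b') c) * poly_eval c \<xi>))"
    using basis_subset assms
    by (intro sum.cong refl) (subst poly_eval_expand, auto simp: poly_eval_combination sum_distrib_left)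
  also have "\<dots> = (\<Sum>b\<in>B. \<Sum>c\<in>B. \<Sum>b'\<in>B. of_real (d b * d b') * (of_real (coord (b * b') c) * poly_eval c \<xi>))"
    by (intro sum.cong refl sum.swap)
  also have "\<dots> = (\<Sum>c\<in>B. \<Sum>b\<in>B. \<Sum>b'\<in>B. of_real (d b * d b') * (of_real (coord (b * b') c) * poly_eval c \<xi>))"
    by (rule sum.swap)
  finally show ?thesis
    by (simp add: poly_eval_combination square_coord_def sum_distrib_right mult.assoc)
qed

lemma square_coord_mem: "(\<And>b. b \<in> B \<Longrightarrow> d b \<in> K) \<Longrightarrow> c \<in> B \<Longrightarrow> square_coord d c \<in> K"
  unfolding square_coord_def using basis_subset by (intro sum_mem mult_mem coord_mem) auto

text \<open>
  At nonreal zeros every number has a square root, so positivity matters at the real zeros only.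
\<close>

lemma square_root_on_zeros:
  fixes s :: "'n mpoly \<Rightarrow> real"
  assumes "\<And>x. x \<in> real_zeros \<Longrightarrow> poly_eval (combination s) x \<ge> 0"
  shows "\<exists>d. \<forall>b\<in>B. square_coord d b = s b"
proof -
  have "\<exists>\<sigma>. \<forall>z\<in>zeros. \<sigma> (conj_point z) = cnj (\<sigma> z) \<and> (\<sigma> z)\<^sup>2 = poly_eval (combination s) z"
    using assms by (intro conjugation_invariant_sqrt)
      (auto simp: poly_eval_conj_point poly_eval_complexify real_zeros_def)
  then obtain \<sigma> where \<sigma>: "\<And>z. z \<in> zeros \<Longrightarrow> \<sigma> (conj_point z) = cnj (\<sigma> z)"
    "\<And>z. z \<in> zeros \<Longrightarrow> (\<sigma> z)\<^sup>2 = poly_eval (combination s) z" by blast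
  obtain d :: "'n mpoly \<Rightarrow> real" where d: "\<forall>z\<in>zeros. poly_eval (combination d) z = \<sigma> z"
    using real_interpolation[of \<sigma>] \<sigma>(1) by blast
  have "(\<Sum>b\<in>B. complex_of_real (square_coord d b - s b) * poly_eval b z) = 0" if "z \<in> zeros" for z
    using poly_eval_square[OF that, of d] d \<sigma>(2)[OF that] that
    by (simp add: poly_eval_combination left_diff_distrib sum_subtractf)
  then have "complex_of_real (square_coord d b - s b) = 0" if "b \<in> B" for b
    using basis_independent_on_zeros[of "\<lambda>b. complex_of_real (square_coord d b - s b)" b] that by blast
  then show ?thesis by (intro exI[of _ d]) auto
qed

text \<open>
  The vectors of a small simplicial cone around the coordinates of \<^term>\<open>F\<close> are still nonnegative at the
  real zeros, so they are squares of real combinations. Approximating the square roots over \<^term>\<open>K\<close> keeps \<^term>\<open>F\<close> in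
  the cone. The cone needs a nonzero center; if \<^term>\<open>F\<close> is in \<^term>\<open>I\<close>, all weights are 0.
\<close>

lemma positive_weighted_sum_of_squares:
  assumes F: "F \<in> R" and pos: "\<And>x. x \<in> real_zeros \<Longrightarrow> poly_eval F x > 0"
  shows "\<exists>\<omega> q. (\<forall>l\<in>B. \<omega> l \<in> K \<and> 0 \<le> \<omega> l \<and> (\<forall>b\<in>B. q l b \<in> K)) \<and>
           F - (\<Sum>l\<in>B. Const (\<omega> l) * (combination (q l))\<^sup>2) \<in> I"
proof (cases "\<forall>b\<in>B. coord F b = 0")
  case True
  then have "F \<in> I" using coord_expand[OF F] by (simp add: combination_def)
  then show ?thesis by (intro exI[of _ "\<lambda>_. 0"] exI[of _ "\<lambda>_ _. 0"]) auto
next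
  case False
  define \<phi> where "\<phi> = coord F"
  obtain b0 where b0: "b0 \<in> B" "\<phi> b0 \<noteq> 0" using False by (auto simp: \<phi>_def)
  define v where "v l b = (if l = b0 then (if b = b0 then 0 else - 1) else (if b = l then 1 else (0 :: real)))" for l b
  have "\<forall>\<^sub>F \<delta> in at_right 0. \<forall>(l, x)\<in>B \<times> real_zeros. poly_eval F x + \<delta> * poly_eval (combination (v l)) x > 0"
  proof (intro eventually_ball_finite ballI)
    fix lx assume "lx \<in> B \<times> real_zeros"
    then obtain l x where lx: "lx = (l, x)" "x \<in> real_zeros" by auto
    have "((\<lambda>\<delta>. poly_eval F x + \<delta> * poly_eval (combination (v l)) x) \<longlongrightarrow>
        poly_eval F x + 0 * poly_eval (combination (v l)) x) (at_right 0)"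
      by (intro tendsto_intros)
    then have "\<forall>\<^sub>F \<delta> in at_right 0. poly_eval F x + \<delta> * poly_eval (combination (v l)) x > 0"
      using pos[OF lx(2)] by (intro order_tendstoD(1)) auto
    then show "\<forall>\<^sub>F \<delta> in at_right 0. case lx of (l, x) \<Rightarrow> poly_eval F x + \<delta> * poly_eval (combination (v l)) x > 0"
      by (simp add: lx)
  qed (use finite_basis in auto)
  moreover have "\<forall>\<^sub>F \<delta> :: real in at_right 0. \<delta> > 0" by (rule eventually_at_right_less)
  ultimately have "\<forall>\<^sub>F \<delta> :: real in at_right 0. (\<forall>(l, x)\<in>B \<times> real_zeros. poly_eval F x + \<delta> * poly_eval (combination (v l)) x > 0) \<and> \<delta> > 0"
    by (rule eventually_conj)
  from eventually_happens'[OF trivial_limit_at_right_real this] obtain \<delta> :: real where \<delta>: "\<delta> > 0"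
    "\<And>l x. l \<in> B \<Longrightarrow> x \<in> real_zeros \<Longrightarrow> poly_eval F x + \<delta> * poly_eval (combination (v l)) x > 0" by auto
  define s where "s l b = \<phi> b + \<delta> * v l b" for l b
  have F_real: "poly_eval F x = poly_eval (combination \<phi>) x" if "x \<in> real_zeros" for x
    using real_zeros_eval[OF coord_expand[OF F] that] by (simp add: poly_eval_diff \<phi>_def)
  have "\<exists>d. \<forall>b\<in>B. square_coord d b = s l b" if "l \<in> B" for l
  proof (rule square_root_on_zeros)
    fix x assume x: "x \<in> real_zeros"
    have "poly_eval (combination (s l)) x = poly_eval F x + \<delta> * poly_eval (combination (v l)) x"
      by (simp add: F_real[OF x] poly_eval_combination s_def sum.distrib distrib_right sum_distrib_left mult.assoc)
    then show "poly_eval (combination (s l)) x \<ge> 0" using \<delta>(2)[OF that x] by simp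
  qed
  then obtain d where d: "\<And>l b. l \<in> B \<Longrightarrow> b \<in> B \<Longrightarrow> square_coord (d l) b = s l b" by metis
  obtain \<tau> where \<tau>: "\<And>k l. k \<in> B \<Longrightarrow> l \<in> B \<Longrightarrow> (\<Sum>b\<in>B. \<tau> k b * s l b) = (if k = l then 1 else 0)"
    "\<And>k. k \<in> B \<Longrightarrow> (\<Sum>b\<in>B. \<tau> k b * \<phi> b) > 0"
    using simplicial_cone_around[OF finite_basis b0(1), of \<phi> \<delta>] b0(2) \<delta>(1) unfolding s_def v_def by auto
  have \<phi>_mem: "\<phi> b \<in> K" if "b \<in> B" for b using coord_mem[OF F that] by (simp add: \<phi>_def)
  obtain \<epsilon> where \<epsilon>: "\<epsilon> > 0" "\<And>s'. \<forall>l\<in>B. \<forall>b\<in>B. s' l b \<in> K \<and> \<bar>s' l b - s l b\<bar> < \<epsilon> \<Longrightarrow>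
      \<exists>x. (\<forall>l\<in>B. x l \<in> K \<and> 0 \<le> x l) \<and> (\<forall>b\<in>B. \<phi> b = (\<Sum>l\<in>B. x l * s' l b))"
    using perturbed_simplicial_cone[OF finite_basis _ \<tau> \<phi>_mem] b0(1) by blast
  have "\<forall>l b. \<exists>u. (\<forall>n :: nat. u n \<in> K) \<and> u \<longlonglongrightarrow> d l b"
    using approximating_sequence by metis
  then obtain u where u: "\<And>l b n. u l b n \<in> K" "\<And>l b. u l b \<longlonglongrightarrow> d l b" by metis
  have "\<forall>\<^sub>F n in sequentially. \<forall>(l, b)\<in>B \<times> B. \<bar>square_coord (\<lambda>b. u l b n) b - s l b\<bar> < \<epsilon>"
  proof (intro eventually_ball_finite ballI)
    fix lb assume "lb \<in> B \<times> B"
    then obtain l b where lb: "lb = (l, b)" "l \<in> B" "b \<in> B" by auto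
    have "(\<lambda>n. square_coord (\<lambda>b. u l b n) b) \<longlonglongrightarrow> square_coord (d l) b"
      unfolding square_coord_def using u(2) by (auto intro!: tendsto_intros)
    then have "\<forall>\<^sub>F n in sequentially. \<bar>square_coord (\<lambda>b. u l b n) b - s l b\<bar> < \<epsilon>"
      using \<epsilon>(1) d lb by (auto simp: tendsto_iff dist_real_def)
    then show "\<forall>\<^sub>F n in sequentially. case lb of (l, b) \<Rightarrow> \<bar>square_coord (\<lambda>b. u l b n) b - s l b\<bar> < \<epsilon>"
      by (simp add: lb)
  qed (use finite_basis in auto)
  then obtain n where n: "\<forall>(l, b)\<in>B \<times> B. \<bar>square_coord (\<lambda>b. u l b n) b - s l b\<bar> < \<epsilon>"
    using eventually_happens'[OF trivial_limit_sequentially] by blast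
  define q where "q l b = u l b n" for l b
  have "\<forall>l\<in>B. \<forall>b\<in>B. square_coord (q l) b \<in> K \<and> \<bar>square_coord (q l) b - s l b\<bar> < \<epsilon>"
    using n u(1) by (auto simp: q_def[abs_def] intro!: square_coord_mem)
  from \<epsilon>(2)[OF this] obtain \<omega> where \<omega>: "\<forall>l\<in>B. \<omega> l \<in> K \<and> 0 \<le> \<omega> l"
    "\<And>b. b \<in> B \<Longrightarrow> \<phi> b = (\<Sum>l\<in>B. \<omega> l * square_coord (q l) b)" by auto
  have "F - (\<Sum>l\<in>B. Const (\<omega> l) * (combination (q l))\<^sup>2) \<in> I"
  proof (rule vanishing_in_ideal)
    show "F - (\<Sum>l\<in>B. Const (\<omega> l) * (combination (q l))\<^sup>2) \<in> R"
      using F \<omega>(1) u(1) by (intro diff_in sum_in mult_in Const_in power_in combination_in) (auto simp: q_def)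
    fix \<xi> assume \<xi>: "\<xi> \<in> zeros"
    have "poly_eval F \<xi> = (\<Sum>b\<in>B. of_real (\<phi> b) * poly_eval b \<xi>)"
      using poly_eval_expand[OF F \<xi>] by (simp add: poly_eval_combination \<phi>_def)
    also have "\<dots> = (\<Sum>b\<in>B. \<Sum>l\<in>B. of_real (\<omega> l) * (of_real (square_coord (q l) b) * poly_eval b \<xi>))"
      by (intro sum.cong refl) (simp add: \<omega>(2) sum_distrib_right mult.assoc)
    also have "\<dots> = (\<Sum>l\<in>B. of_real (\<omega> l) * poly_eval (combination (square_coord (q l))) \<xi>)"
      by (subst sum.swap) (simp add: poly_eval_combination sum_distrib_left)
    also have "\<dots> = poly_eval (\<Sum>l\<in>B. Const (\<omega> l) * (combination (q l))\<^sup>2) \<xi>"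
      by (simp add: poly_eval_ring_hom poly_eval_square[OF \<xi>])
    finally show "poly_eval (F - (\<Sum>l\<in>B. Const (\<omega> l) * (combination (q l))\<^sup>2)) \<xi> = 0"
      by (simp add: poly_eval_diff)
  qed
  then show ?thesis using \<omega>(1) u(1) by (intro exI[of _ \<omega>] exI[of _ q]) (auto simp: q_def)
qed

end

section \<open>Nonnegativity on the semialgebraic set\<close>

context finite_quotient
begin

text \<open>
  One square for each \<^term>\<open>g i\<close> is enough to make \<^term>\<open>F\<close> positive at all real zeros. The target values \<open>v i x\<close> of its
  root are such that every negative \<^term>\<open>g i\<close> contributes \<open>\<bar>F x\<bar> + 1\<close> and the others contribute nothing.
\<close>

lemma certificate_of_positive:
  assumes F: "F \<in> R" and g: "\<And>i. i \<in> A \<Longrightarrow> g i \<in> R" and A: "finite A"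
    and pos: "\<And>x. x \<in> real_zeros \<Longrightarrow> (\<And>i. i \<in> A \<Longrightarrow> poly_eval (g i) x \<ge> 0) \<Longrightarrow> poly_eval F x > 0"
  shows "\<exists>\<omega> q u. (\<forall>l\<in>B. \<omega> l \<in> K \<and> 0 \<le> \<omega> l \<and> (\<forall>b\<in>B. q l b \<in> K)) \<and> (\<forall>i\<in>A. \<forall>b\<in>B. u i b \<in> K) \<and>
     F - ((\<Sum>l\<in>B. Const (\<omega> l) * (combination (q l))\<^sup>2) + (\<Sum>i\<in>A. (combination (u i))\<^sup>2 * g i)) \<in> I"
proof -
  define v where "v i x = (if poly_eval (g i) x < 0
      then sqrt ((\<bar>poly_eval F x\<bar> + 1) / (- poly_eval (g i) x)) else 0)" for i x
  have v2: "(v i x)\<^sup>2 * poly_eval (g i) x = (if poly_eval (g i) x < 0 then - (\<bar>poly_eval F x\<bar> + 1) else 0)" for i x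
    by (auto simp: v_def real_sqrt_pow2 divide_nonneg_neg field_simps)
  have limit_pos: "poly_eval F x - (\<Sum>i\<in>A. (v i x)\<^sup>2 * poly_eval (g i) x) > 0" if x: "x \<in> real_zeros" for x
  proof (cases "\<forall>i\<in>A. poly_eval (g i) x \<ge> 0")
    case True
    then have "(\<Sum>i\<in>A. (v i x)\<^sup>2 * poly_eval (g i) x) = 0"
      by (intro sum.neutral) (auto simp: v_def)
    then show ?thesis using pos[OF x] True by simp
  next
    case False
    then obtain j where j: "j \<in> A" "poly_eval (g j) x < 0" by (auto simp: not_le)
    have "(\<Sum>i\<in>A. (v i x)\<^sup>2 * poly_eval (g i) x) \<le> (\<Sum>i\<in>A. if i = j then - (\<bar>poly_eval F x\<bar> + 1) else 0)"
      using j(2) by (intro sum_mono) (auto simp: v2)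
    also have "\<dots> = - (\<bar>poly_eval F x\<bar> + 1)" using j A by simp
    finally show ?thesis by linarith
  qed
  have "\<exists>u. (\<forall>n :: nat. \<forall>b. u n b \<in> K) \<and>
      (\<forall>x\<in>real_zeros. (\<lambda>n. poly_eval (combination (u n)) x) \<longlonglongrightarrow> v i x)" for i
    using approximate_values[of "v i"] by metis
  then obtain w where w: "\<And>i n b. w i n b \<in> K"
    "\<And>i x. x \<in> real_zeros \<Longrightarrow> (\<lambda>n :: nat. poly_eval (combination (w i n)) x) \<longlonglongrightarrow> v i x"
    by metis
  define G where "G n = F - (\<Sum>i\<in>A. (combination (w i n))\<^sup>2 * g i)" for n
  have "\<forall>\<^sub>F n in sequentially. \<forall>x\<in>real_zeros. poly_eval (G n) x > 0"
  proof (intro eventually_ball_finite ballI)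
    fix x assume x: "x \<in> real_zeros"
    have "(\<lambda>n. poly_eval (G n) x) \<longlonglongrightarrow> poly_eval F x - (\<Sum>i\<in>A. (v i x)\<^sup>2 * poly_eval (g i) x)"
      unfolding G_def poly_eval_ring_hom using w(2)[OF x] by (intro tendsto_intros)
    then show "\<forall>\<^sub>F n in sequentially. poly_eval (G n) x > 0"
      using limit_pos[OF x] by (rule order_tendstoD(1))
  qed simp
  then obtain n where n: "\<And>x. x \<in> real_zeros \<Longrightarrow> poly_eval (G n) x > 0"
    using eventually_happens'[OF trivial_limit_sequentially] by blast
  have "G n \<in> R"
    unfolding G_def using F g w(1) by (intro diff_in sum_in mult_in power_in combination_in) auto
  then obtain \<omega> q where "\<forall>l\<in>B. \<omega> l \<in> K \<and> 0 \<le> \<omega> l \<and> (\<forall>b\<in>B. q l b \<in> K)"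
    "G n - (\<Sum>l\<in>B. Const (\<omega> l) * (combination (q l))\<^sup>2) \<in> I"
    using positive_weighted_sum_of_squares[OF _ n] by blast
  then show ?thesis
    using w(1) by (intro exI[of _ \<omega>] exI[of _ q] exI[of _ "\<lambda>i. w i n"]) (simp add: G_def algebra_simps)
qed

text \<open>
  The idempotent \<open>e\<close> reduces the claim to the positive polynomial \<open>f + 1 - e\<close>. After multiplication by
  \<open>e\<^sup>2\<close>, the factors \<open>e q\<close> are replaced by the combinations of \<^term>\<open>B\<close> with the same class (\<open>red\<close> below).
\<close>

theorem certificate_of_nonnegative:
  assumes f: "f \<in> R" and g: "\<And>i. i \<in> A \<Longrightarrow> g i \<in> R" and A: "finite A"
    and nonneg: "\<And>x. x \<in> real_zeros \<Longrightarrow> (\<And>i. i \<in> A \<Longrightarrow> poly_eval (g i) x \<ge> 0) \<Longrightarrow> poly_eval f x \<ge> 0"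
  shows "\<exists>\<omega> q u. (\<forall>l\<in>B. \<omega> l \<in> K \<and> 0 \<le> \<omega> l \<and> (\<forall>b\<in>B. q l b \<in> K)) \<and> (\<forall>i\<in>A. \<forall>b\<in>B. u i b \<in> K) \<and>
     f - ((\<Sum>l\<in>B. Const (\<omega> l) * (combination (q l))\<^sup>2) + (\<Sum>i\<in>A. (combination (u i))\<^sup>2 * g i)) \<in> I"
proof -
  obtain w where w: "w \<in> R" "f - f\<^sup>2 * w \<in> I" using von_neumann_regular[OF f] by blast
  define e where "e = f * w"
  define F where "F = f + 1 - e"
  have e: "e \<in> R" and F: "F \<in> R" using f w by (auto simp: e_def F_def)
  have dichotomy: "poly_eval f x = 0 \<and> poly_eval e x = 0 \<or> poly_eval e x = 1"
    if "poly_eval (f - f\<^sup>2 * w) x = 0" for x :: "'c :: {real_algebra_1, field} ^ 'n"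
  proof -
    have "poly_eval f x * (1 - poly_eval f x * poly_eval w x) = 0"
      using that by (simp add: poly_eval_ring_hom algebra_simps power2_eq_square)
    then show ?thesis by (auto simp: e_def poly_eval_mult)
  qed
  have F_pos: "poly_eval F x > 0" if x: "x \<in> real_zeros" and "\<And>i. i \<in> A \<Longrightarrow> poly_eval (g i) x \<ge> 0" for x
  proof -
    have fx: "poly_eval f x \<ge> 0" using nonneg that by blast
    have "poly_eval (f - f\<^sup>2 * w) x = 0" using w x real_zeros_eval by blast
    from dichotomy[OF this] show ?thesis
    proof
      assume e1: "poly_eval e x = 1"
      then have "poly_eval f x \<noteq> 0" by (auto simp: e_def poly_eval_mult)
      then show ?thesis using e1 fx by (simp add: F_def poly_eval_ring_hom)
    qed (simp add: F_def poly_eval_ring_hom)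
  qed
  obtain \<omega> q u where cert: "\<forall>l\<in>B. \<omega> l \<in> K \<and> 0 \<le> \<omega> l \<and> (\<forall>b\<in>B. q l b \<in> K)" "\<forall>i\<in>A. \<forall>b\<in>B. u i b \<in> K"
    "F - ((\<Sum>l\<in>B. Const (\<omega> l) * (combination (q l))\<^sup>2) + (\<Sum>i\<in>A. (combination (u i))\<^sup>2 * g i)) \<in> I"
    using certificate_of_positive[where g = g, OF F g A F_pos] by blast
  define red where "red d = coord (e * combination d)" for d
  have red_mem: "red d b \<in> K" if "b \<in> B" "\<And>b. b \<in> B \<Longrightarrow> d b \<in> K" for d b
    unfolding red_def using that e combination_in by (intro coord_mem) auto
  have red_eval: "poly_eval (combination (red d)) \<xi> = poly_eval e \<xi> * poly_eval (combination d) \<xi>"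
    if "\<xi> \<in> zeros" "\<And>b. b \<in> B \<Longrightarrow> d b \<in> K" for d \<xi>
    using poly_eval_expand[of "e * combination d" \<xi>] that e combination_in[of d]
    by (simp add: red_def poly_eval_mult)
  have "f - ((\<Sum>l\<in>B. Const (\<omega> l) * (combination (red (q l)))\<^sup>2) + (\<Sum>i\<in>A. (combination (red (u i)))\<^sup>2 * g i)) \<in> I"
  proof (rule vanishing_in_ideal)
    show "f - ((\<Sum>l\<in>B. Const (\<omega> l) * (combination (red (q l)))\<^sup>2) + (\<Sum>i\<in>A. (combination (red (u i)))\<^sup>2 * g i)) \<in> R"
      using f g cert by (intro diff_in add_in sum_in mult_in power_in combination_in Const_in red_mem) auto
    fix \<xi> assume \<xi>: "\<xi> \<in> zeros"
    have q: "poly_eval (combination (red (q l))) \<xi> = poly_eval e \<xi> * poly_eval (combination (q l)) \<xi>" if "l \<in> B" for l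
      using cert(1) that by (intro red_eval[OF \<xi>]) auto
    have u: "poly_eval (combination (red (u i))) \<xi> = poly_eval e \<xi> * poly_eval (combination (u i)) \<xi>" if "i \<in> A" for i
      using cert(2) that by (intro red_eval[OF \<xi>]) auto
    have "poly_eval ((\<Sum>l\<in>B. Const (\<omega> l) * (combination (red (q l)))\<^sup>2) + (\<Sum>i\<in>A. (combination (red (u i)))\<^sup>2 * g i)) \<xi> =
        (poly_eval e \<xi>)\<^sup>2 * poly_eval ((\<Sum>l\<in>B. Const (\<omega> l) * (combination (q l))\<^sup>2) + (\<Sum>i\<in>A. (combination (u i))\<^sup>2 * g i)) \<xi>"
      by (simp add: poly_eval_ring_hom q u power_mult_distrib distrib_left sum_distrib_left mult_ac)
    also have "poly_eval ((\<Sum>l\<in>B. Const (\<omega> l) * (combination (q l))\<^sup>2) + (\<Sum>i\<in>A. (combination (u i))\<^sup>2 * g i)) \<xi> = poly_eval F \<xi>"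
      using cert(3) \<xi> by (auto simp: zeros_def poly_eval_diff)
    also have "(poly_eval e \<xi>)\<^sup>2 * poly_eval F \<xi> = poly_eval f \<xi>"
    proof -
      have "poly_eval (f - f\<^sup>2 * w) \<xi> = 0" using w \<xi> by (auto simp: zeros_def)
      from dichotomy[OF this] show ?thesis by (auto simp: F_def poly_eval_ring_hom)
    qed
    finally show "poly_eval (f - ((\<Sum>l\<in>B. Const (\<omega> l) * (combination (red (q l)))\<^sup>2) +
        (\<Sum>i\<in>A. (combination (red (u i)))\<^sup>2 * g i))) \<xi> = 0"
      by (simp add: poly_eval_diff)
  qed
  then show ?thesis
    using cert red_mem
    by (intro exI[of _ \<omega>] exI[of _ "\<lambda>l. red (q l)"] exI[of _ "\<lambda>i. red (u i)"]) auto
qed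

end

context real_field
begin

lemma gen_ideal_finite_family:
  fixes h :: "nat \<Rightarrow> 'n mpoly"
  shows "gen_ideal K (h ` {1..s}) = {\<Sum>j=1..s. p j * h j | p. \<forall>j\<in>{1..s}. p j \<in> R}"
proof (intro equalityI subsetI)
  fix a assume "a \<in> gen_ideal K (h ` {1..s})"
  then obtain F c where F: "a = (\<Sum>x\<in>F. c x * x)" "F \<subseteq> h ` {1..s}" "\<forall>x\<in>F. c x \<in> R"
    by (auto simp: gen_ideal_def lin_combs_def)
  \<comment> \<open>Two generators may coincide, so the coefficient of each element of \<^term>\<open>F\<close> goes to one chosen index.\<close>
  obtain J where J: "J \<subseteq> {1..s}" "inj_on h J" "F = h ` J"
    using subset_image_inj[of F h "{1..s}"] F(2) by blast
  define p where "p j = (if j \<in> J then c (h j) else 0)" for j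
  have "a = (\<Sum>j\<in>J. p j * h j)"
    using J by (simp add: F(1) sum.reindex p_def)
  also have "\<dots> = (\<Sum>j=1..s. p j * h j)"
    using J by (intro sum.mono_neutral_left) (auto simp: p_def)
  finally have "a = (\<Sum>j=1..s. p j * h j)" .
  moreover have "\<forall>j\<in>{1..s}. p j \<in> R"
    using F(3) J(3) by (simp add: p_def)
  ultimately show "a \<in> {\<Sum>j=1..s. p j * h j | p. \<forall>j\<in>{1..s}. p j \<in> R}" by blast
next
  fix a assume "a \<in> {\<Sum>j=1..s. p j * h j | p. \<forall>j\<in>{1..s}. p j \<in> R}"
  then obtain p where p: "a = (\<Sum>j=1..s. p j * h j)" "\<forall>j\<in>{1..s}. p j \<in> R" by blast
  define c where "c x = (\<Sum>j | j \<in> {1..s} \<and> h j = x. p j)" for x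
  have "a = (\<Sum>x\<in>h ` {1..s}. \<Sum>j | j \<in> {1..s} \<and> h j = x. p j * h j)"
    unfolding p(1) by (rule sum.image_gen) simp
  also have "\<dots> = (\<Sum>x\<in>h ` {1..s}. c x * x)"
    unfolding c_def sum_distrib_right by (intro sum.cong) auto
  finally show "a \<in> gen_ideal K (h ` {1..s})"
    unfolding gen_ideal_def lin_combs_def using p(2)
    by (intro CollectI exI[of _ "h ` {1..s}"] exI[of _ c]) (auto simp: c_def intro!: sum_in)
qed

lemma K_span_finite:
  assumes "finite B"
  shows "K_span K B = {\<Sum>b\<in>B. Const (c b) * b | c. \<forall>b\<in>B. c b \<in> K}"
proof (intro equalityI subsetI)
  fix a assume "a \<in> K_span K B"
  then obtain F c where F: "a = (\<Sum>b\<in>F. c b * b)" "F \<subseteq> B" "\<forall>b\<in>F. c b \<in> Const ` K"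
    by (auto simp: K_span_def lin_combs_def)
  have "\<forall>b\<in>F. \<exists>k. k \<in> K \<and> c b = Const k" using F(3) by blast
  then obtain k where k: "\<And>b. b \<in> F \<Longrightarrow> k b \<in> K \<and> c b = Const (k b)"
    using bchoice[of F "\<lambda>b k. k \<in> K \<and> c b = Const k"] by blast
  have "a = (\<Sum>b\<in>F. Const (if b \<in> F then k b else 0) * b)"
    using k by (simp add: F(1))
  also have "\<dots> = (\<Sum>b\<in>B. Const (if b \<in> F then k b else 0) * b)"
    using assms F(2) by (intro sum.mono_neutral_left) auto
  finally have "a = (\<Sum>b\<in>B. Const (if b \<in> F then k b else 0) * b)" .
  moreover have "\<forall>b\<in>B. (if b \<in> F then k b else 0) \<in> K" using k by simp
  ultimately show "a \<in> {\<Sum>b\<in>B. Const (c b) * b | c. \<forall>b\<in>B. c b \<in> K}"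
    by (intro CollectI exI[of _ "\<lambda>b. if b \<in> F then k b else 0"]) blast
next
  fix a assume "a \<in> {\<Sum>b\<in>B. Const (c b) * b | c. \<forall>b\<in>B. c b \<in> K}"
  then obtain c where "a = (\<Sum>b\<in>B. Const (c b) * b)" "\<forall>b\<in>B. c b \<in> K" by blast
  then show "a \<in> K_span K B"
    using assms unfolding K_span_def lin_combs_def
    by (intro CollectI exI[of _ B] exI[of _ "\<lambda>b. Const (c b)"]) auto
qed

end

lemma residue_class_eq_iff:
  assumes "0 \<in> I" "\<And>a b. a \<in> I \<Longrightarrow> b \<in> I \<Longrightarrow> a + b \<in> I" "\<And>a. a \<in> I \<Longrightarrow> - a \<in> I"
  shows "residue_class I p = residue_class I q \<longleftrightarrow> p - q \<in> I"
proof
  assume "residue_class I p = residue_class I q"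
  moreover have "p \<in> residue_class I p" using assms(1) by (force simp: residue_class_def)
  ultimately show "p - q \<in> I" by (auto simp: residue_class_def)
next
  have sub: "residue_class I p \<subseteq> residue_class I q" if "p - q \<in> I" for p q
  proof
    fix a assume "a \<in> residue_class I p"
    then obtain b where "b \<in> I" "a = p + b" by (auto simp: residue_class_def)
    then have "a = q + ((p - q) + b)" "(p - q) + b \<in> I" using assms(2) that by auto
    then show "a \<in> residue_class I q" unfolding residue_class_def by blast
  qed
  assume "p - q \<in> I"
  moreover from this have "q - p \<in> I" using assms(3) by fastforce
  ultimately show "residue_class I p = residue_class I q" using sub by blast
qed

theorem corollary2:
  fixes K :: "real set"
    and r s D :: nat
    and g h :: "nat \<Rightarrow> 'n::finite mpoly"
    and I B :: "'n mpoly set"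
    and f :: "'n mpoly"
  assumes "real_subfield K"
    and "\<forall>i\<in>{1..r}. g i \<in> poly_ring K"
    and "\<forall>j\<in>{1..s}. h j \<in> poly_ring K"
    and "I = gen_ideal K (h ` {1..s})"
    and "zero_dimensional I"
    and "radical_ideal K I"
    and "monomial_basis K I B"
    and "finite B" and "card B = D"
    and "f \<in> poly_ring K"
  shows "(\<forall>\<xi>\<in>semialg_set r g s h. poly_eval f \<xi> \<ge> 0) \<longleftrightarrow>
    (\<exists>(\<omega> :: nat \<Rightarrow> nat \<Rightarrow> real) (q :: nat \<Rightarrow> nat \<Rightarrow> 'n mpoly) (p :: nat \<Rightarrow> 'n mpoly).
       (\<forall>i\<in>{0..r}. \<forall>k\<in>{1..D}. \<omega> i k \<in> K \<and> 0 \<le> \<omega> i k \<and> q i k \<in> K_span K B) \<and>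
       (\<forall>j\<in>{1..s}. p j \<in> poly_ring K) \<and>
       f = (\<Sum>k=1..D. Const (\<omega> 0 k) * (q 0 k)\<^sup>2)
         + (\<Sum>i=1..r. (\<Sum>k=1..D. Const (\<omega> i k) * (q i k)\<^sup>2) * g i)
         + (\<Sum>j=1..s. p j * h j))"
    (is "?nonneg \<longleftrightarrow> ?certificate")
proof
  assume ?certificate
  then obtain \<omega> q p where cert:
    "\<forall>i\<in>{0..r}. \<forall>k\<in>{1..D}. 0 \<le> \<omega> i k"
    "f = (\<Sum>k=1..D. Const (\<omega> 0 k) * (q 0 k)\<^sup>2)
       + (\<Sum>i=1..r. (\<Sum>k=1..D. Const (\<omega> i k) * (q i k)\<^sup>2) * g i) + (\<Sum>j=1..s. p j * h j)"
    by blast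
  show ?nonneg
  proof
    fix \<xi> assume \<xi>: "\<xi> \<in> semialg_set r g s h"
    have "poly_eval f \<xi> = (\<Sum>k=1..D. \<omega> 0 k * (poly_eval (q 0 k) \<xi>)\<^sup>2)
        + (\<Sum>i=1..r. (\<Sum>k=1..D. \<omega> i k * (poly_eval (q i k) \<xi>)\<^sup>2) * poly_eval (g i) \<xi>)"
      unfolding cert(2) using \<xi> by (simp add: poly_eval_ring_hom semialg_set_def)
    also have "\<dots> \<ge> 0"
      using \<xi> cert(1) by (intro add_nonneg_nonneg sum_nonneg mult_nonneg_nonneg) (auto simp: semialg_set_def)
    finally show "poly_eval f \<xi> \<ge> 0" .
  qed
next
  assume nonneg: ?nonneg
  interpret real_field K by unfold_locales (fact assms(1))
  have I: "I = {\<Sum>j=1..s. p j * h j | p. \<forall>j\<in>{1..s}. p j \<in> R}"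
    using assms(4) unfolding gen_ideal_finite_family .
  have I_memI: "(\<Sum>j=1..s. p j * h j) \<in> I" if "\<And>j. j \<in> {1..s} \<Longrightarrow> p j \<in> R" for p
    using that unfolding I by blast
  have I0: "0 \<in> I" using I_memI[of "\<lambda>_. 0"] by simp
  have I_add: "a + b \<in> I" if ab: "a \<in> I" "b \<in> I" for a b
  proof -
    obtain p p' where "a = (\<Sum>j=1..s. p j * h j)" "b = (\<Sum>j=1..s. p' j * h j)"
      "\<forall>j\<in>{1..s}. p j \<in> R" "\<forall>j\<in>{1..s}. p' j \<in> R" using ab unfolding I by blast
    then show ?thesis
      using I_memI[of "\<lambda>j. p j + p' j"] by (simp add: distrib_right sum.distrib)
  qed
  have I_mult: "t * a \<in> I" if ta: "t \<in> R" "a \<in> I" for t a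
  proof -
    obtain p where "a = (\<Sum>j=1..s. p j * h j)" "\<forall>j\<in>{1..s}. p j \<in> R" using ta(2) unfolding I by blast
    then show ?thesis
      using I_memI[of "\<lambda>j. t * p j"] ta(1) by (simp add: sum_distrib_left mult.assoc)
  qed
  have I_uminus: "- a \<in> I" if "a \<in> I" for a
    using I_mult[OF _ that, of "- 1"] by simp
  have residue: "residue_class I p = residue_class I q \<longleftrightarrow> p - q \<in> I" for p q
    using I0 I_add I_uminus by (rule residue_class_eq_iff)
  interpret finite_quotient K I B
  proof
    show "I \<subseteq> R"
    proof
      fix a assume "a \<in> I"
      then obtain p where "a = (\<Sum>j=1..s. p j * h j)" "\<forall>j\<in>{1..s}. p j \<in> R" unfolding I by blast
      then show "a \<in> R" using assms(3) by (auto intro!: sum_in)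
    qed
    show "p \<in> I" if "p \<in> R" "p ^ m \<in> I" "m \<ge> 1" for p m
      using that assms(6) unfolding radical_ideal_def by blast
    show "finite {z :: complex ^ 'n. \<forall>p\<in>I. poly_eval p z = 0}"
      using assms(5) by (simp add: zero_dimensional_def)
    show "B \<subseteq> R"
      using assms(7) by (auto simp: monomial_basis_def monomials_def)
    show "\<exists>c. (\<forall>b\<in>B. c b \<in> K) \<and> p - (\<Sum>b\<in>B. Const (c b) * b) \<in> I" if p: "p \<in> R" for p
    proof -
      have "\<forall>p\<in>R. \<exists>q\<in>K_span K B. p - q \<in> I"
        using assms(7) unfolding monomial_basis_def residue by (elim conjE)
      then obtain q where "q \<in> K_span K B" "p - q \<in> I" using p by blast
      moreover from this(1) obtain c where "q = (\<Sum>b\<in>B. Const (c b) * b)" "\<forall>b\<in>B. c b \<in> K"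
        unfolding K_span_finite[OF assms(8)] by blast
      ultimately show ?thesis by blast
    qed
    show "c b = 0" if "\<And>b. b \<in> B \<Longrightarrow> c b \<in> K" "(\<Sum>b\<in>B. Const (c b) * b) \<in> I" "b \<in> B" for c b
    proof -
      have "\<forall>F c. finite F \<and> F \<subseteq> B \<and> (\<forall>b\<in>F. c b \<in> K) \<and> (\<Sum>b\<in>F. Const (c b) * b) - 0 \<in> I \<longrightarrow>
          (\<forall>b\<in>F. c b = 0)"
        using assms(7) unfolding monomial_basis_def residue by (elim conjE)
      from spec[OF spec[OF this, of B], of c] show ?thesis using that assms(8) by simp
    qed
  qed (use assms(8) I0 I_add I_mult in auto)
  have h_I: "h j \<in> I" if "j \<in> {1..s}" for j
    using I_memI[of "\<lambda>i. if i = j then 1 else 0"] that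
    by (simp add: if_distrib[of "\<lambda>c. c * _"] cong: if_cong)
  have "poly_eval f x \<ge> 0" if "x \<in> real_zeros" "\<And>i. i \<in> {1..r} \<Longrightarrow> poly_eval (g i) x \<ge> 0" for x
    using nonneg that real_zeros_eval[OF h_I] by (auto simp: semialg_set_def)
  then obtain \<omega> q u where cert: "\<forall>l\<in>B. \<omega> l \<in> K \<and> 0 \<le> \<omega> l \<and> (\<forall>b\<in>B. q l b \<in> K)"
    "\<forall>i\<in>{1..r}. \<forall>b\<in>B. u i b \<in> K"
    "f - ((\<Sum>l\<in>B. Const (\<omega> l) * (combination (q l))\<^sup>2) + (\<Sum>i=1..r. (combination (u i))\<^sup>2 * g i)) \<in> I"
    using certificate_of_nonnegative[OF assms(10), of "{1..r}" g] assms(2) by auto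
  from cert(3) obtain p where p: "\<forall>j\<in>{1..s}. p j \<in> R"
    "f - ((\<Sum>l\<in>B. Const (\<omega> l) * (combination (q l))\<^sup>2) + (\<Sum>i=1..r. (combination (u i))\<^sup>2 * g i)) =
     (\<Sum>j=1..s. p j * h j)"
    unfolding I by blast
  have span: "combination d \<in> K_span K B" if "\<forall>b\<in>B. d b \<in> K" for d
    using that unfolding K_span_finite[OF assms(8)] combination_def by blast
  obtain \<beta> where \<beta>: "bij_betw \<beta> {1..D} B"
    using assms(8,9) by (metis card_atLeastAtMost diff_Suc_1 finite_atLeastAtMost finite_same_card_bij)
  \<comment> \<open>For \<open>i \<ge> 1\<close> a single square suffices; it gets the index \<open>k = 1\<close> and the other weights vanish.\<close>
  define \<omega>' where "\<omega>' i k = (if i = 0 then \<omega> (\<beta> k) else if k = 1 then 1 else 0)" for i k :: nat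
  define q' where "q' i k = combination (if i = 0 then q (\<beta> k) else u i)" for i k :: nat
  have "(\<Sum>k=1..D. Const (\<omega>' 0 k) * (q' 0 k)\<^sup>2) = (\<Sum>l\<in>B. Const (\<omega> l) * (combination (q l))\<^sup>2)"
    unfolding \<omega>'_def q'_def using sum.reindex_bij_betw[OF \<beta>, of "\<lambda>l. Const (\<omega> l) * (combination (q l))\<^sup>2"] by simp
  moreover have "(\<Sum>k=1..D. Const (\<omega>' i k) * (q' i k)\<^sup>2) = (combination (u i))\<^sup>2" if "i \<in> {1..r}" for i
  proof (cases "D = 0")
    case True
    then have "B = {}" using assms(8,9) by simp
    then have "combination (u i) = 0" unfolding combination_def by simp
    then show ?thesis using True by simp
  next
    case False
    have "(\<Sum>k=1..D. Const (\<omega>' i k) * (q' i k)\<^sup>2) = (\<Sum>k=1..D. if k = 1 then (combination (u i))\<^sup>2 else 0)"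
      using that by (intro sum.cong) (auto simp: \<omega>'_def q'_def)
    then show ?thesis using False by simp
  qed
  ultimately have "f = (\<Sum>k=1..D. Const (\<omega>' 0 k) * (q' 0 k)\<^sup>2)
      + (\<Sum>i=1..r. (\<Sum>k=1..D. Const (\<omega>' i k) * (q' i k)\<^sup>2) * g i) + (\<Sum>j=1..s. p j * h j)"
    using p(2) by (simp add: algebra_simps)
  moreover have "\<omega>' i k \<in> K \<and> 0 \<le> \<omega>' i k \<and> q' i k \<in> K_span K B" if "i \<in> {0..r}" "k \<in> {1..D}" for i k
    using that cert(1,2) bij_betwE[OF \<beta>] by (auto simp: \<omega>'_def q'_def intro!: span)
  ultimately show ?certificate using p(1) by blast
qed

end
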